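(* Let $c$ be a real number and let $m=m(n)$ be a sequence of positive integers with $m(n)\to+\infty$ as $n\to+\infty$. For each $n$ let $(X_{n,1},Q_{n,1}),\dots,(X_{n,m},Q_{n,m})$ be independent (not necessarily identically distributed) bivariate random variables with values in $\{0,1,\dots,n\}\times[0,1]$, and let $G_{[n,m]}$ be the random graph on $[n]$ defined by this sequence. Let $i_*$ be uniformly distributed in $[m]$ and independent of $\{(X_{n,i},Q_{n,i}),\ i\in[m]\}$. Assume that, as $n\to+\infty$, $(X_{n,i_*},Q_{n,i_*})$ converges in distribution to some bivariate random variable $(X,Q)$ with values in $\{0,1,2,\dots\}\times[0,1]$ such that $\mathbf{E}\bigl(Q\,\mathbb{I}_{\{X\ge 2\}}\bigr)>0$ and $\mathbf{E}\bigl(Xh(X,Q)\ln(1+X)\bigr)<\infty$. Assume, in addition, that $$\mathbf{E}\bigl(X_{n,i_*}h(X_{n,i_*},Q_{n,i_*})\ln(1+X_{n,i_*})\bigr)\to\mathbf{E}\bigl(Xh(X,Q)\ln(1+X)\bigr)\qquad\text{as } n\to+\infty.$$ Put $$\kappa_n=\mathbf{E}\bigl(X_{n,i_*}h(X_{n,i_*},Q_{n,i_*})\bigr)=\frac1m\sum_{i\in[m]}\mathbf{E}\bigl(X_{n,i}h(X_{n,i},Q_{n,i})\bigr),\qquad \lambda^*_{n,m}=\ln n-\frac{m}{n}\kappa_n.$$ Then $$\lim_{n\to+\infty}\mathbf{P}\{G_{[n,m]}\text{ is connected}\}=\begin{cases}1, & \text{if }\lambda^*_{n,m}\to-\infty,\\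 e^{-e^{c}}, & \text{if }\lambda^*_{n,m}\to c,\\ 0, & \text{if }\lambda^*_{n,m}\to+\infty,\end{cases}$$ where the convergence of $\lambda^*_{n,m}$ is as $n\to+\infty$.
   Context: Notation: $[n]=\{1,\dots,n\}$, $(x)_+=\max\{x,0\}$, $\mathbb{I}_{\mathcal A}$ is the indicator of the event $\mathcal A$. For $(x,q)\in[0,+\infty)\times[0,1]$, $h(x,q)=1-(1-q)^{(x-1)_+}$, with the convention $0^0=1$. Random graph $G_{[n,m]}$: given independent bivariate random variables $(X_{n,1},Q_{n,1}),\dots,(X_{n,m},Q_{n,m})$ with values in $\{0,1,\dots,n\}\times[0,1]$, define independent random graphs $G_{n,i}=(\mathcal V_{n,i},\mathcal E_{n,i})$, $1\le i\le m$, as follows. First sample $(X_{n,i},Q_{n,i})$. Then, given $(X_{n,i},Q_{n,i})$, select $\mathcal V_{n,i}\subset[n]$ uniformly at random among all subsets of size $X_{n,i}$, and link every pair of elements of $\mathcal V_{n,i}$ by an edge independently at random with probability $Q_{n,i}$. The graph $G_{[n,m]}$ has vertex set $[n]$ and edge set $\bigcup_{i=1}^m\mathcal E_{n,i}$; it is said to be defined by the sequence $(X_{n,1},Q_{n,1}),\dots,(X_{n,m},Q_{n,m})$. The random variable $(X_{n,i_*},Q_{n,i_*})$ has the mixture distribution $\mathbf{P}\{X_{n,i_*}=x,\,Q_{n,i_*}\in[0,t]\}=\frac1m\sum_{i\in[m]}\mathbf{P}\{X_{n,i}=x,\,Q_{n,i}\in[0,t]\}$. *)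

theory Defs
  imports "HOL-Probability.Probability"
begin

text \<open>
  In Isabelle/HOL \<^term>\<open>0 powr 0 = (0::real)\<close>, so the convention that the zeroth power of zero
  is one has to be built into the definition by hand.
\<close>

definition h :: "real \<Rightarrow> real \<Rightarrow> real" where
  "h x q = 1 - (if max (x - 1) 0 = 0 then 1 else (1 - q) powr max (x - 1) 0)"

lemma h_of_nat:
  assumes "q \<in> {0..1}"
  shows "h (real k) q = 1 - (1 - q) ^ (k - 1)"
proof (cases "k \<le> 1")
  case True
  then show ?thesis by (auto simp: h_def)
next
  case False
  then have "max (real k - 1) 0 = real (k - 1)" "k - 1 > 0" by (auto simp: of_nat_diff)
  then have "h (real k) q = 1 - (1 - q) powr real (k - 1)" by (simp add: h_def)
  then show ?thesis
    using assms \<open>k - 1 > 0\<close> by (cases "q = 1") (simp_all add: powr_realpow del: of_nat_diff)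
qed


definition pairs :: "nat set \<Rightarrow> nat set set" where
  "pairs S = {e. e \<subseteq> S \<and> card e = 2}"

definition graph_connected :: "nat set \<Rightarrow> nat set set \<Rightarrow> bool" where
  "graph_connected S F \<longleftrightarrow> (\<forall>u\<in>S. \<forall>v\<in>S. (u, v) \<in> {(a, b). a \<in> S \<and> b \<in> S \<and> {a, b} \<in> F}\<^sup>*)"


text \<open>
  The joint law of the vertex set and the edge set of a single layer, for given size \<open>x \<le> n\<close>
  and edge probability \<open>q\<close>.
\<close>

definition layer_pmf :: "nat \<Rightarrow> nat \<Rightarrow> real \<Rightarrow> (nat set \<times> nat set set) pmf" where
  "layer_pmf n x q =
     bind_pmf (pmf_of_set {S. S \<subseteq> {1..n} \<and> card S = x}) (\<lambda>S.
       map_pmf (\<lambda>link. (S, {e \<in> pairs S. link e}))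
         (Pi_pmf (pairs S) False (\<lambda>_. bernoulli_pmf q)))"

text \<open>
  \<open>V\<close> and \<open>E\<close> are the vertex set and the edge set of a random graph which, given \<open>(X, Q)\<close>, has
  conditional law \<open>layer_pmf n X Q\<close>.  Since \<open>(V, E)\<close> takes finitely many values, it is enough to
  prescribe the conditional probability of each value; the last clause is the defining property
  of that conditional probability with respect to \<open>(X, Q)\<close>.
\<close>

definition random_layer ::
  "'a measure \<Rightarrow> nat \<Rightarrow> ('a \<Rightarrow> nat) \<Rightarrow> ('a \<Rightarrow> real) \<Rightarrow> ('a \<Rightarrow> nat set) \<Rightarrow> ('a \<Rightarrow> nat set set) \<Rightarrow> bool"
where
  "random_layer M n X Q V E \<longleftrightarrow>
     X \<in> measurable M (count_space UNIV) \<and> Q \<in> borel_measurable M \<and>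
     (\<forall>\<omega>\<in>space M. X \<omega> \<in> {0..n} \<and> Q \<omega> \<in> {0..1}) \<and>
     V \<in> measurable M (count_space (Pow {1..n})) \<and>
     E \<in> measurable M (count_space (Pow (pairs {1..n}))) \<and>
     (\<forall>A \<in> sets (count_space UNIV \<Otimes>\<^sub>M borel). \<forall>S F.
        measure M {\<omega>\<in>space M. (X \<omega>, Q \<omega>) \<in> A \<and> V \<omega> = S \<and> E \<omega> = F} =
        (\<integral>\<omega>. indicator A (X \<omega>, Q \<omega>) * pmf (layer_pmf n (X \<omega>) (Q \<omega>)) (S, F) \<partial>M))"

definition independent_random_layers ::
  "'a measure \<Rightarrow> nat \<Rightarrow> nat \<Rightarrow> (nat \<Rightarrow> 'a \<Rightarrow> nat) \<Rightarrow> (nat \<Rightarrow> 'a \<Rightarrow> real) \<Rightarrow>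
     (nat \<Rightarrow> 'a \<Rightarrow> nat set) \<Rightarrow> (nat \<Rightarrow> 'a \<Rightarrow> nat set set) \<Rightarrow> bool"
where
  "independent_random_layers M n m X Q V E \<longleftrightarrow>
     prob_space M \<and>
     (\<forall>i\<in>{1..m}. random_layer M n (X i) (Q i) (V i) (E i)) \<and>
     prob_space.indep_vars M
       (\<lambda>_. (count_space UNIV \<Otimes>\<^sub>M borel) \<Otimes>\<^sub>M
            (count_space (Pow {1..n}) \<Otimes>\<^sub>M count_space (Pow (pairs {1..n}))))
       (\<lambda>i \<omega>. ((X i \<omega>, Q i \<omega>), (V i \<omega>, E i \<omega>))) {1..m}"

definition union_edges :: "nat \<Rightarrow> (nat \<Rightarrow> 'a \<Rightarrow> nat set set) \<Rightarrow> 'a \<Rightarrow> nat set set" where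
  "union_edges m E \<omega> = (\<Union>i\<in>{1..m}. E i \<omega>)"


text \<open>
  Independence of the index from the whole family is stated through the generated sigma-algebras,
  because \<^term>\<open>prob_space.indep_var\<close> requires both random elements to have the same value type.
\<close>

definition uniform_independent_index ::
  "'a measure \<Rightarrow> nat \<Rightarrow> (nat \<Rightarrow> 'a \<Rightarrow> nat) \<Rightarrow> (nat \<Rightarrow> 'a \<Rightarrow> real) \<Rightarrow> ('a \<Rightarrow> nat) \<Rightarrow> bool"
where
  "uniform_independent_index M m X Q I \<longleftrightarrow>
     I \<in> measurable M (count_space {1..m}) \<and>
     distr M (count_space {1..m}) I = uniform_count_measure {1..m} \<and>
     prob_space.indep_set M
       (sets (vimage_algebra (space M) I (count_space {1..m})))
       (sets (vimage_algebra (space M) (\<lambda>\<omega>. \<lambda>i\<in>{1..m}. (X i \<omega>, Q i \<omega>))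
         (\<Pi>\<^sub>M i\<in>{1..m}. count_space UNIV \<Otimes>\<^sub>M borel)))"

definition at_index :: "('a \<Rightarrow> nat) \<Rightarrow> (nat \<Rightarrow> 'a \<Rightarrow> 'b) \<Rightarrow> 'a \<Rightarrow> 'b" where
  "at_index I Y \<omega> = Y (I \<omega>) \<omega>"

text \<open>
  Convergence in distribution of random elements that may live on different probability spaces;
  the library's \<^const>\<open>weak_conv_m\<close> covers real random variables only.
\<close>

definition converges_in_distribution ::
  "(nat \<Rightarrow> 'a measure) \<Rightarrow> (nat \<Rightarrow> 'a \<Rightarrow> 'c::topological_space) \<Rightarrow> 'b measure \<Rightarrow> ('b \<Rightarrow> 'c) \<Rightarrow> bool"
where
  "converges_in_distribution M Y N Z \<longleftrightarrow>
     (\<forall>f :: 'c \<Rightarrow> real. continuous_on UNIV f \<longrightarrow> bounded (range f) \<longrightarrow>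
        (\<lambda>n. \<integral>\<omega>. f (Y n \<omega>) \<partial>M n) \<longlonglongrightarrow> (\<integral>\<omega>. f (Z \<omega>) \<partial>N))"

text \<open>The law of \<open>(X, Q)\<close> at a uniform independent index is the average of the individual laws.\<close>

lemma expectation_at_index:
  fixes g :: "nat \<times> real \<Rightarrow> real"
  assumes M: "prob_space M"
    and idx: "uniform_independent_index M m X Q I"
    and g: "g \<in> borel_measurable (count_space UNIV \<Otimes>\<^sub>M borel)"
    and int: "\<And>i. i \<in> {1..m} \<Longrightarrow> integrable M (\<lambda>\<omega>. g (X i \<omega>, Q i \<omega>))"
  shows "(\<integral>\<omega>. g (at_index I X \<omega>, at_index I Q \<omega>) \<partial>M) =
         (\<Sum>i=1..m. \<integral>\<omega>. g (X i \<omega>, Q i \<omega>) \<partial>M) / real m"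
proof -
  interpret prob_space M by fact
  let ?C = "count_space {1..m}" and ?P = "\<Pi>\<^sub>M i\<in>{1..m}. count_space UNIV \<Otimes>\<^sub>M (borel :: real measure)"
  let ?Y = "\<lambda>\<omega>. \<lambda>i\<in>{1..m}. (X i \<omega>, Q i \<omega>)"
  have I[measurable]: "I \<in> measurable M ?C"
    and d: "distr M ?C I = uniform_count_measure {1..m}"
    and ind: "indep_set (sets (vimage_algebra (space M) I ?C)) (sets (vimage_algebra (space M) ?Y ?P))"
    using idx by (auto simp: uniform_independent_index_def)
  have Imem: "I \<omega> \<in> {1..m}" if "\<omega> \<in> space M" for \<omega>
    using measurable_space[OF I that] by simp
  have pI: "(\<integral>\<omega>. indicator {i} (I \<omega>) \<partial>M) = 1 / real m" if i: "i \<in> {1..m}" for i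
  proof -
    have "(\<integral>\<omega>. indicator {i} (I \<omega>) \<partial>M) = (\<integral>k. indicator {i} k \<partial>distr M ?C I :: real)"
      using I by (subst integral_distr) (auto simp del: One_nat_def)
    also have "\<dots> = (\<integral>k. indicator {i} k \<partial>uniform_count_measure {1..m})" by (simp only: d)
    also have "\<dots> = 1 / real m"
      using i measure_uniform_count_measure[of "{1..m}" "{i}"]
      by (simp add: space_uniform_count_measure)
    finally show ?thesis .
  qed
  have ii: "indep_var borel (\<lambda>\<omega>. indicator {i} (I \<omega>) :: real) borel (\<lambda>\<omega>. g (X i \<omega>, Q i \<omega>))"
    if i: "i \<in> {1..m}" for i
  proof -
    have gi: "(\<lambda>y. g (y i)) \<in> borel_measurable ?P"
      using measurable_compose[OF measurable_component_singleton[OF i] g] .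
    have Yi: "(\<lambda>\<omega>. g (X i \<omega>, Q i \<omega>)) = (\<lambda>\<omega>. g (?Y \<omega> i))"
      using i by simp
    have "?Y \<in> space M \<rightarrow> space ?P"
      by (auto simp: space_PiM space_pair_measure)
    then have "(\<lambda>\<omega>. g (?Y \<omega> i)) \<in> borel_measurable (vimage_algebra (space M) ?Y ?P)"
      by (rule measurable_compose[OF measurable_vimage_algebra1 gi])
    then have 1: "(\<lambda>\<omega>. g (X i \<omega>, Q i \<omega>)) \<in> borel_measurable (vimage_algebra (space M) ?Y ?P)"
      by (simp only: Yi)
    have "I \<in> space M \<rightarrow> space ?C"
      using Imem by auto
    then have 2: "(\<lambda>\<omega>. indicator {i} (I \<omega>) :: real) \<in> borel_measurable (vimage_algebra (space M) I ?C)"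
      by (rule measurable_compose[OF measurable_vimage_algebra1]) simp
    have sub: "sigma_sets (space M) {f -` A \<inter> space M |A. A \<in> sets borel} \<subseteq> sets (vimage_algebra (space M) h H)"
      if "f \<in> borel_measurable (vimage_algebra (space M) h H)" for f :: "'a \<Rightarrow> real" and h and H :: "'c measure"
    proof -
      have "{f -` A \<inter> space M |A. A \<in> sets borel} \<subseteq> sets (vimage_algebra (space M) h H)"
        using measurable_sets[OF that] by auto
      from sets.sigma_sets_subset[OF this] show ?thesis by simp
    qed
    have "random_variable borel (\<lambda>\<omega>. indicator {i} (I \<omega>) :: real)"
      by (rule measurable_compose[OF I]) simp
    moreover have "random_variable borel (\<lambda>\<omega>. g (X i \<omega>, Q i \<omega>))"
      using int[OF i] by simp
    moreover have "indep_set (sigma_sets (space M) {(\<lambda>\<omega>. indicator {i} (I \<omega>) :: real) -` A \<inter> space M |A. A \<in> sets borel})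
       (sigma_sets (space M) {(\<lambda>\<omega>. g (X i \<omega>, Q i \<omega>)) -` A \<inter> space M |A. A \<in> sets borel})"
      using ind unfolding indep_set_def
      by (rule indep_sets_mono_sets) (use sub[OF 1] sub[OF 2] in \<open>auto split: bool.split\<close>)
    ultimately show ?thesis unfolding indep_var_eq by blast
  qed
  have intI: "integrable M (\<lambda>\<omega>. indicator {i} (I \<omega>) :: real)" if "i \<in> {1..m}" for i
  proof (rule integrable_const_bound[where B = 1])
    show "(\<lambda>\<omega>. indicator {i} (I \<omega>) :: real) \<in> borel_measurable M"
      by (rule measurable_compose[OF I]) simp
  qed (auto simp: indicator_def)
  have "(\<integral>\<omega>. g (at_index I X \<omega>, at_index I Q \<omega>) \<partial>M) =
        (\<integral>\<omega>. (\<Sum>i=1..m. indicator {i} (I \<omega>) * g (X i \<omega>, Q i \<omega>)) \<partial>M)"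
  proof (rule Bochner_Integration.integral_cong[OF refl])
    fix \<omega> assume "\<omega> \<in> space M"
    then have "I \<omega> \<in> {1..m}" by (rule Imem)
    then show "g (at_index I X \<omega>, at_index I Q \<omega>) =
        (\<Sum>i=1..m. indicator {i} (I \<omega>) * g (X i \<omega>, Q i \<omega>))"
      by (simp add: at_index_def indicator_def if_distrib[of "\<lambda>x. x * _"] cong: if_cong)
  qed
  also have "\<dots> = (\<Sum>i=1..m. \<integral>\<omega>. indicator {i} (I \<omega>) * g (X i \<omega>, Q i \<omega>) \<partial>M)"
    by (rule Bochner_Integration.integral_sum) (auto intro!: indep_var_integrable ii intI int)
  also have "\<dots> = (\<Sum>i=1..m. (1 / real m) * (\<integral>\<omega>. g (X i \<omega>, Q i \<omega>) \<partial>M))"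
  proof (rule sum.cong[OF refl])
    fix i assume i: "i \<in> {1..m}"
    show "(\<integral>\<omega>. indicator {i} (I \<omega>) * g (X i \<omega>, Q i \<omega>) \<partial>M) =
          (1 / real m) * (\<integral>\<omega>. g (X i \<omega>, Q i \<omega>) \<partial>M)"
      using indep_var_lebesgue_integral[OF ii[OF i] intI[OF i] int[OF i]] pI[OF i] by simp
  qed
  finally show ?thesis by (simp add: sum_divide_distrib)
qed

end

theory Submission
  imports Defs "HOL-Real_Asymp.Real_Asymp"
begin

text \<open>
  Call a vertex set closed if no edge leaves it.  The graph is disconnected iff it has a nonempty
  closed set with at most \<open>n/2\<close> vertices, and a closed set with one vertex is an isolated vertex.
  A layer of size \<open>x\<close> whose vertex set meets a set of \<open>k\<close> vertices without being contained in it
  joins that set to its complement with probability at least \<open>h x q\<close>; hence \<open>k\<close> given vertices form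
  a closed set with probability at most \<open>(exp (lam n + o(1)) / n)^k\<close> as long as \<open>k \<le> n^(1/4)\<close>, and
  with a much smaller probability than \<open>1 / (n choose k)\<close> for larger \<open>k\<close>.  On the other hand,
  by a union bound within each layer, they are all isolated with probability at least
  \<open>(exp (lam n - o(1)) / n)^k\<close>.  So for critical \<open>lam n\<close> the two expected numbers agree
  asymptotically: the number of isolated vertices is asymptotically Poisson by Bonferroni's
  inequalities, and there are no other small components.  The logarithm in the moment condition
  makes \<open>E (X h(X, Q); X > sqrt n)\<close> of order \<open>o(1 / ln n)\<close>, which turns the errors in the exponents,
  of relative size \<open>o(1 / ln n)\<close>, into \<open>o(1)\<close>.
\<close>

section \<open>Closed and isolated vertex sets\<close>

text \<open>Working with closed sets rather than components keeps independence: being closed is an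
  intersection of events about single layers, with no demand of connectedness inside the set. The
  price is that sets of isolated vertices are closed as well, so in the critical case the expected
  number of closed k-sets does not vanish; only its difference from the expected number of isolated
  k-sets does. Three size ranges need different treatment of large layers. For k <= n^(1/4) the
  cutoff sqrt n keeps x k / n below n^(-1/4). For larger k that cutoff becomes useless, and a fixed
  cutoff is taken; it loses a constant fraction of the exponent, which is affordable because n
  choose k is then at most exp (k (1 + 3/4 ln n)). For k linear in n any fixed positive proportion
  of ln n wins against 2^n, so the mean of h is enough. As the layers are not identically
  distributed, a single layer mean may be as large as n. The lower bounds therefore have to control
  the sum of the squared layer means, not only their average. Finally, if lam n tends to minus
  infinity, the exponent is no longer of order ln n, and errors must be measured against the
  exponent itself.\<close>

definition closed_vertices :: "nat set \<Rightarrow> nat set set \<Rightarrow> bool" where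
  "closed_vertices S F \<longleftrightarrow> (\<forall>e\<in>F. e \<subseteq> S \<or> e \<inter> S = {})"

definition isolated_vertices :: "nat set \<Rightarrow> nat set set \<Rightarrow> bool" where
  "isolated_vertices S F \<longleftrightarrow> (\<forall>e\<in>F. e \<inter> S = {})"

lemma isolated_imp_closed: "isolated_vertices S F \<Longrightarrow> closed_vertices S F"
  by (auto simp: isolated_vertices_def closed_vertices_def)

lemma closed_vertices_compl:
  assumes "F \<subseteq> pairs U" "closed_vertices S F"
  shows "closed_vertices (U - S) F"
  using assms unfolding closed_vertices_def pairs_def by blast

lemma pairsE:
  assumes "e \<in> pairs U"
  obtains a b where "e = {a, b}" "a \<noteq> b" "a \<in> U" "b \<in> U"
  using assms unfolding pairs_def by (auto simp: card_2_iff)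

text \<open>The vertices reachable from \<open>u\<close> form a closed set that misses
  \<open>v\<close>, and so does its complement with the roles exchanged; the smaller of the two is
  taken.\<close>

lemma not_connected_closed:
  assumes F: "F \<subseteq> pairs U" and fin: "finite U" and nc: "\<not> graph_connected U F"
  obtains S where "S \<subseteq> U" "S \<noteq> {}" "2 * card S \<le> card U" "closed_vertices S F"
proof -
  let ?r = "{(a, b). a \<in> U \<and> b \<in> U \<and> {a, b} \<in> F}"
  obtain u v where uv: "u \<in> U" "v \<in> U" "(u, v) \<notin> ?r\<^sup>*"
    using nc unfolding graph_connected_def by blast
  define R where "R = {w \<in> U. (u, w) \<in> ?r\<^sup>*}"
  have R: "R \<subseteq> U" "u \<in> R" "v \<in> U - R" using uv by (auto simp: R_def)
  have step: "b \<in> R" if "a \<in> R" "b \<in> U" "{a, b} \<in> F" for a b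
  proof -
    have "(a, b) \<in> ?r" using that by (auto simp: R_def)
    then show ?thesis using that by (auto simp: R_def intro: rtrancl_into_rtrancl)
  qed
  have cR: "closed_vertices R F"
    unfolding closed_vertices_def
  proof
    fix e assume "e \<in> F"
    then obtain a b where ab: "e = {a, b}" "a \<in> U" "b \<in> U" using F by (blast elim: pairsE)
    have "{b, a} \<in> F" using ab \<open>e \<in> F\<close> by (simp add: insert_commute)
    then show "e \<subseteq> R \<or> e \<inter> R = {}"
      using step[of a b] step[of b a] ab \<open>e \<in> F\<close> by auto
  qed
  have card: "card R + card (U - R) = card U"
    using R fin by (metis card_Diff_subset card_mono le_add_diff_inverse finite_subset)
  show thesis
  proof (cases "2 * card R \<le> card U")
    case True
    then show thesis using that[of R] R cR by blast
  next
    case False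
    then show thesis using that[of "U - R"] R cR card closed_vertices_compl[OF F cR] by auto
  qed
qed

lemma connected_no_isolated:
  assumes "graph_connected U F" "v \<in> U" "w \<in> U" "v \<noteq> w"
  shows "\<not> isolated_vertices {v} F"
proof
  assume iso: "isolated_vertices {v} F"
  have "(v, w) \<in> {(a, b). a \<in> U \<and> b \<in> U \<and> {a, b} \<in> F}\<^sup>*"
    using assms unfolding graph_connected_def by blast
  then show False
    by (cases rule: converse_rtranclE) (use assms iso in \<open>auto simp: isolated_vertices_def\<close>)
qed

section \<open>A single layer\<close>

lemma finite_pairs: "finite U \<Longrightarrow> finite (pairs U)"
  unfolding pairs_def by (rule finite_subset[of _ "Pow U"]) auto

lemma prob_no_links:
  assumes "finite W" "D \<subseteq> pairs W" "q \<in> {0..1}"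
  shows "measure_pmf.prob (Pi_pmf (pairs W) False (\<lambda>_. bernoulli_pmf q)) {link. \<forall>e\<in>D. \<not> link e} =
         (1 - q) ^ card D"
proof -
  let ?p = "Pi_pmf (pairs W) False (\<lambda>_. bernoulli_pmf q)"
  let ?B = "\<lambda>e. if e \<in> D then {False} else UNIV"
  have fin: "finite (pairs W)" using assms(1) by (rule finite_pairs)
  have "{link. \<forall>e\<in>D. \<not> link e} = Pi (pairs W) ?B"
    using assms(2) by (auto simp: Pi_def)
  then have "measure_pmf.prob ?p {link. \<forall>e\<in>D. \<not> link e} =
      (\<Prod>e\<in>pairs W. measure_pmf.prob (bernoulli_pmf q) (?B e))"
    by (simp add: measure_Pi_pmf_Pi[OF fin])
  also have "\<dots> = (\<Prod>e\<in>pairs W. if e \<in> D then 1 - q else 1)"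
    using assms(3) by (intro prod.cong) (auto simp: measure_pmf_single)
  also have "\<dots> = (\<Prod>e\<in>pairs W \<inter> D. 1 - q)"
    by (rule prod.inter_restrict[OF fin, symmetric])
  also have "pairs W \<inter> D = D" using assms(2) by auto
  finally show ?thesis by simp
qed

lemma prob_layer_eq:
  assumes "x \<le> n"
  shows "measure_pmf.prob (layer_pmf n x q) A =
    (\<Sum>W | W \<subseteq> {1..n} \<and> card W = x.
       measure_pmf.prob (Pi_pmf (pairs W) False (\<lambda>_. bernoulli_pmf q)) {link. (W, {e \<in> pairs W. link e}) \<in> A})
    / real (n choose x)"
proof -
  let ?U = "{W. W \<subseteq> {1..n} \<and> card W = x}"
  have fin: "finite ?U" by simp
  have cardU: "card ?U = n choose x" using n_subsets[of "{1..n}" x] by simp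
  then have ne: "?U \<noteq> {}" using assms(1) by (metis card.empty zero_less_binomial_iff less_irrefl)
  have "measure_pmf.prob (layer_pmf n x q) A =
     measure_pmf.expectation (pmf_of_set ?U) (\<lambda>W. measure_pmf.prob
       (map_pmf (\<lambda>link. (W, {e \<in> pairs W. link e})) (Pi_pmf (pairs W) False (\<lambda>_. bernoulli_pmf q))) A)"
    unfolding layer_pmf_def bind_pmf.rep_eq o_def id_def
    by (rule measure_pmf.measure_bind[where N = "count_space UNIV"])
       (auto simp: space_subprob_algebra intro!: prob_space_imp_subprob_space measure_pmf.prob_space_axioms)
  also have "\<dots> = (\<Sum>W\<in>?U. measure_pmf.prob
       (map_pmf (\<lambda>link. (W, {e \<in> pairs W. link e})) (Pi_pmf (pairs W) False (\<lambda>_. bernoulli_pmf q))) A) / card ?U"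
    by (rule integral_pmf_of_set[OF ne fin])
  finally show ?thesis by (simp only: cardU measure_map_pmf vimage_def)
qed

text \<open>Closedness and isolation of a vertex set both say that certain links \<open>D W\<close>
  are absent, so one formula serves for both events.\<close>

lemma prob_layer:
  assumes "x \<le> n" "q \<in> {0..1}"
    and D: "\<And>W. D W \<subseteq> pairs W"
    and A: "\<And>W L. W \<subseteq> {1..n} \<Longrightarrow> (W, {e \<in> pairs W. L e}) \<in> A \<longleftrightarrow> (\<forall>e\<in>D W. \<not> L e)"
  shows "measure_pmf.prob (layer_pmf n x q) A =
    (\<Sum>W | W \<subseteq> {1..n} \<and> card W = x. (1 - q) ^ card (D W)) / real (n choose x)"
  unfolding prob_layer_eq[OF assms(1)]
proof (rule arg_cong2[where f = "(/)"], rule sum.cong)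
  fix W assume "W \<in> {W. W \<subseteq> {1..n} \<and> card W = x}"
  then have W: "W \<subseteq> {1..n}" "finite W" by (auto intro: finite_subset)
  have "{link. (W, {e \<in> pairs W. link e}) \<in> A} = {link. \<forall>e\<in>D W. \<not> link e}"
    unfolding A[OF W(1)] ..
  then show "measure_pmf.prob (Pi_pmf (pairs W) False (\<lambda>_. bernoulli_pmf q)) {link. (W, {e \<in> pairs W. link e}) \<in> A}
     = (1 - q) ^ card (D W)"
    using prob_no_links[OF W(2) D assms(2)] by simp
qed auto

lemma real_choose_Suc: "real (b choose Suc x) = real (b choose x) * (real b - real x) / (real x + 1)"
proof (cases "x \<le> b")
  case True
  have "Suc x * (b choose Suc x) = (b - x) * (b choose x)"
    by (metis binomial_absorb_comp binomial_absorption mult.commute)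
  then have "real (Suc x) * real (b choose Suc x) = (real b - real x) * real (b choose x)"
    using True by (metis of_nat_diff of_nat_mult)
  then show ?thesis by (simp add: field_simps)
qed (simp add: binomial_eq_0)

text \<open>Sampling without replacement: after x marked draws the next one is marked with
  probability (a - x) / (n - x), which is at most a / n.\<close>

lemma choose_ratio_le:
  assumes "a \<le> n" "x \<le> n" 
  shows "real (a choose x) / real (n choose x) \<le> (real a / real n) ^ x"
proof -
  \<comment> \<open>The cross-multiplied form lets the induction run over all \<open>x\<close>,
    including those for which n choose x is zero.\<close>
  have "real (a choose x) * real n ^ x \<le> real (n choose x) * real a ^ x"
  proof (induction x)
    case 0
    then show ?case by simp
  next
    case (Suc x)
    show ?case
    proof (cases "x \<le> a")
      case False
      then show ?thesis by (simp add: binomial_eq_0)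
    next
      case True
      have "(real a - real x) * real n \<le> (real n - real x) * real a"
        using assms(1) by (simp add: algebra_simps mult_right_mono)
      then have "(real (a choose x) * real n ^ x) * ((real a - real x) * real n) \<le>
           (real (n choose x) * real a ^ x) * ((real n - real x) * real a)"
        by (rule mult_mono[OF Suc.IH]) (use True in auto)
      then have "(real (a choose x) * real n ^ x) * ((real a - real x) * real n) / (real x + 1) \<le>
           (real (n choose x) * real a ^ x) * ((real n - real x) * real a) / (real x + 1)"
        by (rule divide_right_mono) simp
      then show ?thesis
        by (simp add: real_choose_Suc mult_ac)
    qed
  qed
  moreover have "real (n choose x) > 0" using assms by simp
  moreover have "real n ^ x > 0" using assms by (cases n) auto
  ultimately show ?thesis by (simp add: field_simps)
qed

lemma card_subsets_containing:
  assumes "v \<in> {1..n}"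
  shows "real (card {W. W \<subseteq> {1..n} \<and> card W = x \<and> v \<in> W}) = real x / real n * real (n choose x)"
proof (cases x)
  case 0
  then have "{W. W \<subseteq> {1..n} \<and> card W = x \<and> v \<in> W} = {}"
    by (auto dest: finite_subset[OF _ finite_atLeastAtMost])
  then show ?thesis using 0 by simp
next
  case (Suc y)
  have "bij_betw (insert v) {W. W \<subseteq> {1..n} - {v} \<and> card W = y} {W. W \<subseteq> {1..n} \<and> card W = x \<and> v \<in> W}"
  proof (rule bij_betw_byWitness[where f' = "\<lambda>W. W - {v}"])
    show "insert v ` {W. W \<subseteq> {1..n} - {v} \<and> card W = y} \<subseteq> {W. W \<subseteq> {1..n} \<and> card W = x \<and> v \<in> W}"
    proof clarify
      fix W assume W: "W \<subseteq> {1..n} - {v}" "y = card W"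
      then have "finite W" by (meson finite_Diff finite_atLeastAtMost finite_subset)
      then show "insert v W \<subseteq> {1..n} \<and> card (insert v W) = x \<and> v \<in> insert v W"
        using W assms Suc by (auto simp: card_insert_if)
    qed
    show "(\<lambda>W. W - {v}) ` {W. W \<subseteq> {1..n} \<and> card W = x \<and> v \<in> W} \<subseteq> {W. W \<subseteq> {1..n} - {v} \<and> card W = y}"
      using Suc by (auto simp: card_Diff_singleton)
  qed auto
  then have "card {W. W \<subseteq> {1..n} \<and> card W = x \<and> v \<in> W} = card {W. W \<subseteq> {1..n} - {v} \<and> card W = y}"
    by (simp add: bij_betw_same_card)
  also have "\<dots> = (n - 1) choose y"
    using assms by (subst n_subsets) auto
  finally have eq: "card {W. W \<subseteq> {1..n} \<and> card W = x \<and> v \<in> W} = (n - 1) choose y" .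
  have n: "n > 0" using assms by auto
  then have "x * (n choose x) = n * ((n - 1) choose y)"
    using Suc binomial_absorption[of y "n"] by simp
  then have "real x * real (n choose x) = real n * real ((n - 1) choose y)"
    by (metis of_nat_mult)
  then show ?thesis using n eq by (simp add: field_simps)
qed

lemma card_pairs_containing:
  assumes "finite W" "v \<in> W"
  shows "card {e \<in> pairs W. v \<in> e} = card W - 1"
proof -
  have "bij_betw (\<lambda>w. {v, w}) (W - {v}) {e \<in> pairs W. v \<in> e}"
    unfolding bij_betw_def
  proof
    show "inj_on (\<lambda>w. {v, w}) (W - {v})" by (auto simp: inj_on_def doubleton_eq_iff)
    show "(\<lambda>w. {v, w}) ` (W - {v}) = {e \<in> pairs W. v \<in> e}"
      using assms by (auto simp: pairs_def card_2_iff image_iff)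
  qed
  from bij_betw_same_card[OF this] show ?thesis using assms(2) by simp
qed

text \<open>With i + 1 vertices inside \<open>S\<close> and j + 1 outside there are (i + 1) (j + 1)
  >= i + j + 1 crossing pairs. The exponent x - 1 in \<open>h\<close> is thus the worst case over
  all ways in which a layer can straddle \<open>S\<close>.\<close>

lemma card_crossing_pairs_ge:
  assumes "finite W" "W \<inter> S \<noteq> {}" "\<not> W \<subseteq> S"
  shows "card W - 1 \<le> card {e \<in> pairs W. \<not> (e \<subseteq> S \<or> e \<inter> S = {})}"
proof -
  let ?P = "(W \<inter> S) \<times> (W - S)"
  have "inj_on (\<lambda>(a, b). {a, b}) ?P" by (auto simp: inj_on_def doubleton_eq_iff)
  then have "card ((\<lambda>(a, b). {a, b}) ` ?P) = card (W \<inter> S) * card (W - S)"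
    by (simp add: card_image card_cartesian_product)
  moreover
  have "(\<lambda>(a, b). {a, b}) ` ?P \<subseteq> {e \<in> pairs W. \<not> (e \<subseteq> S \<or> e \<inter> S = {})}"
  proof clarify
    fix a b assume "a \<in> W" "a \<in> S" "b \<in> W" "b \<notin> S"
    then show "{a, b} \<in> pairs W \<and> \<not> ({a, b} \<subseteq> S \<or> {a, b} \<inter> S = {})"
      by (auto simp: pairs_def card_insert_if)
  qed
  then have "card ((\<lambda>(a, b). {a, b}) ` ?P) \<le> card {e \<in> pairs W. \<not> (e \<subseteq> S \<or> e \<inter> S = {})}"
    using finite_pairs[OF assms(1)] by (intro card_mono) auto
  ultimately have le: "card (W \<inter> S) * card (W - S) \<le> card {e \<in> pairs W. \<not> (e \<subseteq> S \<or> e \<inter> S = {})}"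
    by simp
  have "card (W \<inter> S) > 0" "card (W - S) > 0" using assms by (auto simp: card_gt_0_iff)
  then obtain i j where ij: "card (W \<inter> S) = Suc i" "card (W - S) = Suc j"
    by (metis gr0_implies_Suc)
  have "card W = card (W \<inter> S) + card (W - S)"
    using assms(1) by (metis card_Int_Diff)
  then show ?thesis using le unfolding ij by simp
qed

lemma h_bounds: "q \<in> {0..1} \<Longrightarrow> 0 \<le> h (real x) q \<and> h (real x) q \<le> 1"
  by (simp add: h_of_nat power_le_one)

text \<open>A straddling vertex set leaves \<open>S\<close> closed with probability at most 1 - h.
  The probabilities of missing \<open>S\<close> and of lying inside \<open>S\<close> are bounded by
  those of sampling with replacement.\<close>

lemma prob_layer_closed_le:
  assumes x: "x \<le> n" and q: "q \<in> {0..1}" and S: "S \<subseteq> {1..n}"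
  defines "t \<equiv> real (card S) / real n"
  shows "measure_pmf.prob (layer_pmf n x q) {(W, F). closed_vertices S F} \<le>
    1 - h (real x) q * (1 - (1 - t) ^ x - t ^ x)"
proof -
  define k where "k = card S"
  define a where "a = h (real x) q"
  let ?U = "{W. W \<subseteq> {1..n} \<and> card W = x}"
  let ?D = "\<lambda>W. {e \<in> pairs W. \<not> (e \<subseteq> S \<or> e \<inter> S = {})}"
  have a: "0 \<le> a" "a \<le> 1" using h_bounds[OF q] by (auto simp: a_def)
  have finS: "finite S" using S by (rule finite_subset) simp
  have k: "k \<le> n" using card_mono[OF _ S] by (simp add: k_def)
  have C: "real (n choose x) > 0" using x by simp
  have cards: "real (card ?U) = real (n choose x)"
      "card {W \<in> ?U. W \<inter> S = {}} = (n - k) choose x" "card {W \<in> ?U. W \<subseteq> S} = k choose x"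
  proof -
    show "real (card ?U) = real (n choose x)" using n_subsets[of "{1..n}" x] by simp
    have "{W \<in> ?U. W \<inter> S = {}} = {W. W \<subseteq> {1..n} - S \<and> card W = x}" by auto
    then show "card {W \<in> ?U. W \<inter> S = {}} = (n - k) choose x"
      using S finS by (simp add: n_subsets card_Diff_subset k_def)
    have "{W \<in> ?U. W \<subseteq> S} = {W. W \<subseteq> S \<and> card W = x}" using S by auto
    then show "card {W \<in> ?U. W \<subseteq> S} = k choose x"
      using finS by (simp add: n_subsets k_def)
  qed
  \<comment> \<open>An empty \<open>W\<close> is counted by both indicators; the bracket is then -1,
    and the bound remains true because \<open>a\<close> is nonnegative.\<close>
  have bnd: "(1 - q) ^ card (?D W) \<le>
      1 - a * (1 - of_bool (W \<inter> S = {}) - of_bool (W \<subseteq> S))" if W: "W \<in> ?U" for W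
  proof (cases "W \<inter> S = {} \<or> W \<subseteq> S")
    case True
    have "(1 - q) ^ card (?D W) \<le> 1" using q by (intro power_le_one) auto
    moreover have "a * (1 - of_bool (W \<inter> S = {}) - of_bool (W \<subseteq> S)) \<le> 0"
      using True a by (auto simp: of_bool_def)
    ultimately show ?thesis by linarith
  next
    case False
    have "finite W" using W by (auto intro: finite_subset)
    then have "(1 - q) ^ card (?D W) \<le> (1 - q) ^ (x - 1)"
      using card_crossing_pairs_ge[of W S] False W q by (intro power_decreasing) auto
    also have "\<dots> = 1 - a" using h_of_nat[OF q, of x] by (simp add: a_def)
    finally show ?thesis using False by simp
  qed
  have "measure_pmf.prob (layer_pmf n x q) {(W, F). closed_vertices S F} =
      (\<Sum>W\<in>?U. (1 - q) ^ card (?D W)) / real (n choose x)"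
    by (rule prob_layer[OF x q]) (auto simp: closed_vertices_def)
  also have "\<dots> \<le> (\<Sum>W\<in>?U. 1 - a * (1 - of_bool (W \<inter> S = {}) - of_bool (W \<subseteq> S))) / real (n choose x)"
    using bnd by (intro divide_right_mono sum_mono) auto
  also have "(\<Sum>W\<in>?U. 1 - a * (1 - of_bool (W \<inter> S = {}) - of_bool (W \<subseteq> S))) =
     real (card ?U) - a * (real (card ?U) - real (card {W \<in> ?U. W \<inter> S = {}}) - real (card {W \<in> ?U. W \<subseteq> S}))"
    using sum_of_bool_eq[of ?U "\<lambda>W. W \<inter> S = {}", where ?'a = real]
      sum_of_bool_eq[of ?U "\<lambda>W. W \<subseteq> S", where ?'a = real]
    unfolding sum_subtractf sum_distrib_left[symmetric] Int_Collect[symmetric] by (simp add: Int_def)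
  also have "\<dots> / real (n choose x) =
      1 - a * (1 - real ((n - k) choose x) / real (n choose x) - real (k choose x) / real (n choose x))"
    unfolding cards using C by (simp add: field_simps)
  also have "\<dots> \<le> 1 - a * (1 - (1 - t) ^ x - t ^ x)"
  proof -
    have "(real (n - k) / real n) ^ x = (1 - t) ^ x"
    proof (cases "n = 0")
      case True then show ?thesis using x by simp
    next
      case False then show ?thesis using k by (simp add: t_def k_def[symmetric] of_nat_diff diff_divide_distrib)
    qed
    then have "real ((n - k) choose x) / real (n choose x) \<le> (1 - t) ^ x"
      using choose_ratio_le[of "n - k" n x] x by simp
    moreover have "real (k choose x) / real (n choose x) \<le> t ^ x"
      using choose_ratio_le[OF k x] by (simp add: t_def k_def)
    ultimately show ?thesis using a(1)
      by (intro diff_left_mono mult_left_mono) auto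
  qed
  finally show ?thesis by (simp add: a_def)
qed

text \<open>At most x - 1 links at each vertex of W \<inter> S must be absent, so Bernoulli's
  inequality bounds the conditional probability below by 1 - h |W \<inter> S|. Averaging over
  \<open>W\<close> uses that |W \<inter> S| has mean |S| x / n.\<close>

lemma prob_layer_isolated_ge:
  assumes x: "x \<le> n" and q: "q \<in> {0..1}" and S: "S \<subseteq> {1..n}"
  shows "measure_pmf.prob (layer_pmf n x q) {(W, F). isolated_vertices S F} \<ge>
    1 - real (card S) / real n * (real x * h (real x) q)"
proof -
  define a where "a = h (real x) q"
  let ?U = "{W. W \<subseteq> {1..n} \<and> card W = x}"
  let ?D = "\<lambda>W. {e \<in> pairs W. e \<inter> S \<noteq> {}}"
  have a: "0 \<le> a" "a \<le> 1" using h_bounds[OF q] by (auto simp: a_def)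
  have finS: "finite S" using S by (rule finite_subset) simp
  have C: "real (n choose x) > 0" using x by simp
  have cU: "real (card ?U) = real (n choose x)" using n_subsets[of "{1..n}" x] by simp
  have bnd: "1 - a * real (card (W \<inter> S)) \<le> (1 - q) ^ card (?D W)" if W: "W \<in> ?U" for W
  proof -
    have finW: "finite W" using W by (auto intro: finite_subset)
    have "?D W \<subseteq> (\<Union>v\<in>W \<inter> S. {e \<in> pairs W. v \<in> e})" by (auto simp: pairs_def)
    then have "card (?D W) \<le> card (\<Union>v\<in>W \<inter> S. {e \<in> pairs W. v \<in> e})"
      using finW finite_pairs by (intro card_mono) auto
    also have "\<dots> \<le> (\<Sum>v\<in>W \<inter> S. card {e \<in> pairs W. v \<in> e})"
      using finW by (intro card_UN_le) auto
    also have "\<dots> = (\<Sum>v\<in>W \<inter> S. x - 1)"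
      using finW W by (intro sum.cong) (auto simp: card_pairs_containing)
    finally have le: "card (?D W) \<le> (x - 1) * card (W \<inter> S)" by (simp add: mult.commute)
    have "1 - a * real (card (W \<inter> S)) \<le> (1 - a) ^ card (W \<inter> S)"
      using Bernoulli_inequality[of "- a" "card (W \<inter> S)"] a by (simp add: mult.commute)
    also have "1 - a = (1 - q) ^ (x - 1)" using h_of_nat[OF q, of x] by (simp add: a_def)
    also have "((1 - q) ^ (x - 1)) ^ card (W \<inter> S) = (1 - q) ^ ((x - 1) * card (W \<inter> S))"
      by (simp add: power_mult)
    also have "\<dots> \<le> (1 - q) ^ card (?D W)" using le q by (intro power_decreasing) auto
    finally show ?thesis .
  qed
  have "(\<Sum>W\<in>?U. real (card (W \<inter> S))) = (\<Sum>W\<in>?U. \<Sum>v\<in>S. of_bool (v \<in> W))"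
    using finS by (intro sum.cong) (simp_all add: sum_of_bool_eq Int_commute)
  also have "\<dots> = (\<Sum>v\<in>S. \<Sum>W\<in>?U. of_bool (v \<in> W))" by (rule sum.swap)
  also have "\<dots> = (\<Sum>v\<in>S. real (card {W. W \<subseteq> {1..n} \<and> card W = x \<and> v \<in> W}))"
    by (intro sum.cong refl) (subst sum_of_bool_eq, auto intro!: arg_cong[where f = card])
  also have "\<dots> = (\<Sum>v\<in>S. real x / real n * real (n choose x))"
    using S by (intro sum.cong card_subsets_containing) auto
  finally have sm: "(\<Sum>W\<in>?U. real (card (W \<inter> S))) = real (card S) * (real x / real n * real (n choose x))" by simp
  have "(\<Sum>W\<in>?U. 1 - a * real (card (W \<inter> S))) =
      real (n choose x) - a * (real (card S) * (real x / real n * real (n choose x)))"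
    unfolding sum_subtractf sum_distrib_left[symmetric] sm sum_constant cU by simp
  then have "1 - real (card S) / real n * (real x * a) = (\<Sum>W\<in>?U. 1 - a * real (card (W \<inter> S))) / real (n choose x)"
    using C by (simp add: diff_divide_distrib)
  also have "\<dots> \<le> (\<Sum>W\<in>?U. (1 - q) ^ card (?D W)) / real (n choose x)"
    using bnd by (intro divide_right_mono sum_mono) auto
  also have "\<dots> = measure_pmf.prob (layer_pmf n x q) {(W, F). isolated_vertices S F}"
    by (rule prob_layer[OF x q, symmetric]) (auto simp: isolated_vertices_def)
  finally show ?thesis by (simp add: a_def)
qed

text \<open>Second-order inclusion-exclusion for (1 - t)^x, sharp as x t tends to 0. The remaining
  \<open>t ^ x\<close> is at most t^2 and is absorbed because x^2 - x (x - 1) / 2 >= 1.\<close>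

lemma straddle_prob_ge_quadratic:
  fixes t :: real
  assumes "t \<in> {0..1}" "x \<ge> 2"
  shows "1 - (1 - t) ^ x - t ^ x \<ge> real x * t * (1 - real x * t)"
proof -
  have ind: "(1 - t) ^ j \<le> 1 - real j * t + real j * (real j - 1) / 2 * t\<^sup>2" for j
  proof (induction j)
    case (Suc j)
    have "(1 - t) ^ Suc j \<le> (1 - t) * (1 - real j * t + real j * (real j - 1) / 2 * t\<^sup>2)"
      using Suc assms by (simp add: mult_left_mono)
    also have "\<dots> = 1 - real (Suc j) * t + real (Suc j) * (real (Suc j) - 1) / 2 * t\<^sup>2
         - t * (real j * (real j - 1) / 2 * t\<^sup>2)"
      by (simp add: field_simps power2_eq_square)
    also have "\<dots> \<le> 1 - real (Suc j) * t + real (Suc j) * (real (Suc j) - 1) / 2 * t\<^sup>2"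
      using assms by (cases j) auto
    finally show ?case .
  qed simp
  have "t ^ x \<le> t\<^sup>2" using assms by (intro power_decreasing) auto
  moreover have "1 * t\<^sup>2 \<le> (real x * real x - real x * (real x - 1) / 2) * t\<^sup>2"
  proof (rule mult_right_mono)
    have "2 * 2 \<le> real x * real x" using assms by (intro mult_mono) auto
    then show "1 \<le> real x * real x - real x * (real x - 1) / 2" by (simp add: field_simps)
  qed simp
  ultimately show ?thesis using ind[of x] by (simp add: algebra_simps power2_eq_square)
qed

text \<open>For x = 2 the left side is 2 t (1 - t), which is at least t when t <= 1/2; increasing x
  only decreases both powers.\<close>

lemma straddle_prob_ge_linear:
  fixes t :: real
  assumes "t \<in> {0..1/2}" "x \<ge> 2"
  shows "1 - (1 - t) ^ x - t ^ x \<ge> t"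
proof -
  have "t ^ x \<le> t\<^sup>2" "(1 - t) ^ x \<le> (1 - t)\<^sup>2" using assms by (auto intro!: power_decreasing)
  moreover have "2 * (t * t) \<le> t"
    using assms mult_right_mono[of t "1/2" t] by auto
  ultimately show ?thesis by (simp add: power2_eq_square algebra_simps)
qed

text \<open>The explicit formula makes the conditional probability visibly measurable as a function
  of size and edge probability, and shows that only finitely many values occur.\<close>

lemma pmf_layer:
  assumes x: "x \<le> n" and q: "q \<in> {0..1}"
  shows "pmf (layer_pmf n x q) (S, F) =
    (if S \<subseteq> {1..n} \<and> card S = x \<and> F \<subseteq> pairs S
     then (\<Prod>e\<in>pairs S. if e \<in> F then q else 1 - q) / real (n choose x) else 0)"
proof -
  let ?U = "{W. W \<subseteq> {1..n} \<and> card W = x}"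
  let ?c = "if F \<subseteq> pairs S then \<Prod>e\<in>pairs S. if e \<in> F then q else 1 - q else 0"
  have links: "measure_pmf.prob (Pi_pmf (pairs W) False (\<lambda>_. bernoulli_pmf q))
       {link. (W, {e \<in> pairs W. link e}) \<in> {(S, F)}} = (if S = W then ?c else 0)"
    if W: "W \<in> ?U" for W
  proof (cases "S = W \<and> F \<subseteq> pairs S")
    case True
    have fin: "finite (pairs W)" using W by (auto intro: finite_pairs finite_subset)
    have "{link. (W, {e \<in> pairs W. link e}) \<in> {(S, F)}} = Pi (pairs W) (\<lambda>e. {e \<in> F})"
      using True by (auto simp: Pi_def)
    then have "measure_pmf.prob (Pi_pmf (pairs W) False (\<lambda>_. bernoulli_pmf q))
       {link. (W, {e \<in> pairs W. link e}) \<in> {(S, F)}} =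
       (\<Prod>e\<in>pairs W. measure_pmf.prob (bernoulli_pmf q) {e \<in> F})"
      by (simp only: measure_Pi_pmf_Pi[OF fin])
    also have "\<dots> = (\<Prod>e\<in>pairs W. if e \<in> F then q else 1 - q)"
      using q by (intro prod.cong) (auto simp: measure_pmf_single)
    finally show ?thesis using True by auto
  next
    case False
    then have "{link. (W, {e \<in> pairs W. link e}) \<in> {(S, F)}} = {}" by auto
    then show ?thesis using False by auto
  qed
  have "pmf (layer_pmf n x q) (S, F) = measure_pmf.prob (layer_pmf n x q) {(S, F)}"
    by (simp add: measure_pmf_single)
  also have "\<dots> = (\<Sum>W\<in>?U. if S = W then ?c else 0) / real (n choose x)"
    unfolding prob_layer_eq[OF x] using links by (intro arg_cong2[where f = "(/)"] sum.cong) auto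
  also have "(\<Sum>W\<in>?U. if S = W then ?c else 0) = (if S \<in> ?U then ?c else 0)"
    by (rule sum.delta') simp
  finally show ?thesis by simp
qed

section \<open>The union of independent layers\<close>

locale layered_graph = prob_space M for M :: "'a measure" +
  fixes n m :: nat and X :: "nat \<Rightarrow> 'a \<Rightarrow> nat" and Q :: "nat \<Rightarrow> 'a \<Rightarrow> real"
    and V :: "nat \<Rightarrow> 'a \<Rightarrow> nat set" and E :: "nat \<Rightarrow> 'a \<Rightarrow> nat set set"
  assumes m_pos: "m > 0"
    and layers: "independent_random_layers M n m X Q V E"
begin

lemma layer: "i \<in> {1..m} \<Longrightarrow> random_layer M n (X i) (Q i) (V i) (E i)"
  using layers by (auto simp: independent_random_layers_def)

lemma layer_range:
  assumes "i \<in> {1..m}" "\<omega> \<in> space M"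
  shows "X i \<omega> \<le> n" "Q i \<omega> \<in> {0..1}" "V i \<omega> \<subseteq> {1..n}" "E i \<omega> \<subseteq> pairs {1..n}"
proof -
  from layer[OF assms(1)] assms(2) show "X i \<omega> \<le> n" "Q i \<omega> \<in> {0..1}"
    by (auto simp: random_layer_def)
  from layer[OF assms(1)] assms(2) show "V i \<omega> \<subseteq> {1..n}" "E i \<omega> \<subseteq> pairs {1..n}"
    unfolding random_layer_def by (force dest: measurable_space)+
qed

lemma measurable_layer:
  assumes "i \<in> {1..m}"
  shows "X i \<in> measurable M (count_space UNIV)" "Q i \<in> borel_measurable M"
    "V i \<in> measurable M (count_space (Pow {1..n}))"
    "E i \<in> measurable M (count_space (Pow (pairs {1..n})))"
  using layer[OF assms] unfolding random_layer_def by auto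

lemma integrable_layer:
  assumes i: "i \<in> {1..m}"
    and g: "g \<in> borel_measurable (count_space UNIV \<Otimes>\<^sub>M borel)"
    and B: "\<And>x q. x \<le> n \<Longrightarrow> q \<in> {0..1} \<Longrightarrow> \<bar>g (x, q)\<bar> \<le> B"
  shows "integrable M (\<lambda>\<omega>. g (X i \<omega>, Q i \<omega>) :: real)"
proof (rule integrable_const_bound[where B = B])
  show "AE \<omega> in M. norm (g (X i \<omega>, Q i \<omega>)) \<le> B"
    using layer_range[OF i] B by (intro AE_I2) auto
  note [measurable] = measurable_layer[OF i] g
  show "(\<lambda>\<omega>. g (X i \<omega>, Q i \<omega>)) \<in> borel_measurable M" by measurable
qed

text \<open>The defining identity of the conditional law, taken on the whole range of (X, Q), is
  summed over the finitely many pairs of vertex set and edge set that satisfy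
  \<open>P\<close>.\<close>

lemma prob_edges:
  assumes i: "i \<in> {1..m}"
  shows "integrable M (\<lambda>\<omega>. measure_pmf.prob (layer_pmf n (X i \<omega>) (Q i \<omega>)) {(W, F). P F})" (is ?I)
    and "prob {\<omega> \<in> space M. P (E i \<omega>)} =
      (\<integral>\<omega>. measure_pmf.prob (layer_pmf n (X i \<omega>) (Q i \<omega>)) {(W, F). P F} \<partial>M)" (is ?E)
proof -
  note [measurable] = measurable_layer[OF i]
  let ?T = "Pow {1..n} \<times> {F \<in> Pow (pairs {1..n}). P F}"
  let ?p = "\<lambda>z \<omega>. pmf (layer_pmf n (X i \<omega>) (Q i \<omega>)) z"
  have finT: "finite ?T" by (simp add: finite_pairs)
  have int: "integrable M (?p z)" for z
  proof (rule integrable_const_bound[where B = 1])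
    obtain S F where z: "z = (S, F)" by (cases z)
    have "?p z \<omega> = (if S \<subseteq> {1..n} \<and> F \<subseteq> pairs S then
       (if card S = X i \<omega> then (\<Prod>e\<in>pairs S. if e \<in> F then Q i \<omega> else 1 - Q i \<omega>) / real (n choose X i \<omega>) else 0) else 0)"
      if "\<omega> \<in> space M" for \<omega>
      using layer_range[OF i that] by (simp add: z pmf_layer)
    moreover have "(\<lambda>\<omega>. if S \<subseteq> {1..n} \<and> F \<subseteq> pairs S then
       (if card S = X i \<omega> then (\<Prod>e\<in>pairs S. if e \<in> F then Q i \<omega> else 1 - Q i \<omega>) / real (n choose X i \<omega>) else 0) else 0)
        \<in> borel_measurable M"
      by measurable
    ultimately show "?p z \<in> borel_measurable M" by (simp cong: measurable_cong)
  qed (auto simp: pmf_le_1)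
  have ps: "measure_pmf.prob (layer_pmf n (X i \<omega>) (Q i \<omega>)) {(W, F). P F} = (\<Sum>z\<in>?T. ?p z \<omega>)"
    if \<omega>: "\<omega> \<in> space M" for \<omega>
  proof -
    have "set_pmf (layer_pmf n (X i \<omega>) (Q i \<omega>)) \<subseteq> Pow {1..n} \<times> Pow (pairs {1..n})"
    proof
      fix z assume "z \<in> set_pmf (layer_pmf n (X i \<omega>) (Q i \<omega>))"
      then have "pmf (layer_pmf n (X i \<omega>) (Q i \<omega>)) (fst z, snd z) \<noteq> 0" by (simp add: set_pmf_iff)
      then have "fst z \<subseteq> {1..n}" "snd z \<subseteq> pairs (fst z)"
        unfolding pmf_layer[OF layer_range(1,2)[OF i \<omega>]] by (auto split: if_splits)
      then show "z \<in> Pow {1..n} \<times> Pow (pairs {1..n})"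
        by (cases z) (auto simp: pairs_def)
    qed
    then have "measure_pmf.prob (layer_pmf n (X i \<omega>) (Q i \<omega>)) {(W, F). P F} =
        measure_pmf.prob (layer_pmf n (X i \<omega>) (Q i \<omega>)) ?T"
      by (intro measure_prob_cong_0) (auto simp: set_pmf_iff)
    also have "\<dots> = (\<Sum>z\<in>?T. ?p z \<omega>)" by (rule measure_measure_pmf_finite[OF finT])
    finally show ?thesis .
  qed
  show ?I using ps int by (simp cong: Bochner_Integration.integrable_cong)
  let ?e = "\<lambda>z. {\<omega> \<in> space M. (X i \<omega>, Q i \<omega>) \<in> UNIV \<and> V i \<omega> = fst z \<and> E i \<omega> = snd z}"
  have pe: "prob (?e z) = (\<integral>\<omega>. ?p z \<omega> \<partial>M)" for z
  proof -
    have "UNIV \<in> sets (count_space (UNIV :: nat set) \<Otimes>\<^sub>M (borel :: real measure))"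
      using sets.top[of "count_space (UNIV :: nat set) \<Otimes>\<^sub>M (borel :: real measure)"]
      by (simp add: space_pair_measure)
    then have "prob (?e z) = (\<integral>\<omega>. indicator UNIV (X i \<omega>, Q i \<omega>) * ?p (fst z, snd z) \<omega> \<partial>M)"
      using layer[OF i] unfolding random_layer_def by blast
    then show ?thesis by simp
  qed
  have "{\<omega> \<in> space M. P (E i \<omega>)} = (\<Union>z\<in>?T. ?e z)"
    using layer_range[OF i] by auto
  also have "prob \<dots> = (\<Sum>z\<in>?T. prob (?e z))"
  proof (rule finite_measure_finite_Union[OF finT])
    show "?e ` ?T \<subseteq> events"
      by (auto intro!: sets.sets_Collect_conj)
    show "disjoint_family_on ?e ?T" by (auto simp: disjoint_family_on_def)
  qed
  also have "\<dots> = (\<integral>\<omega>. (\<Sum>z\<in>?T. ?p z \<omega>) \<partial>M)"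
    unfolding pe using int by (simp add: Bochner_Integration.integral_sum)
  also have "\<dots> = (\<integral>\<omega>. measure_pmf.prob (layer_pmf n (X i \<omega>) (Q i \<omega>)) {(W, F). P F} \<partial>M)"
    using ps by (intro Bochner_Integration.integral_cong) auto
  finally show ?E .
qed

lemma prob_all_edges:
  "prob {\<omega> \<in> space M. \<forall>i\<in>{1..m}. P (E i \<omega>)} = (\<Prod>i=1..m. prob {\<omega> \<in> space M. P (E i \<omega>)})"
proof -
  let ?K = "(count_space UNIV \<Otimes>\<^sub>M borel) \<Otimes>\<^sub>M
            (count_space (Pow {1..n}) \<Otimes>\<^sub>M count_space (Pow (pairs {1..n})))
            :: ((nat \<times> real) \<times> nat set \<times> nat set set) measure"
  let ?Z = "\<lambda>i \<omega>. ((X i \<omega>, Q i \<omega>), (V i \<omega>, E i \<omega>))"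
  let ?A = "{z \<in> space ?K. P (snd (snd z))}"
  have ind: "indep_vars (\<lambda>_. ?K) ?Z {1..m}"
    using layers by (simp add: independent_random_layers_def)
  have pre: "?Z i -` ?A \<inter> space M = {\<omega> \<in> space M. P (E i \<omega>)}" if "i \<in> {1..m}" for i
  proof -
    have "?Z i \<omega> \<in> space ?K" if "\<omega> \<in> space M" for \<omega>
      using layer_range(3,4)[OF \<open>i \<in> {1..m}\<close> that] by (simp add: space_pair_measure)
    then show ?thesis by auto
  qed
  have [measurable]: "P \<in> measurable (count_space (Pow (pairs {1..n}))) (count_space UNIV)" by simp
  have "?A \<in> sets ?K" by measurable
  then have "prob (\<Inter>i\<in>{1..m}. ?Z i -` ?A \<inter> space M) = (\<Prod>i=1..m. prob (?Z i -` ?A \<inter> space M))"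
    using m_pos by (intro indep_varsD[OF ind]) auto
  moreover have "(\<Inter>i\<in>{1..m}. ?Z i -` ?A \<inter> space M) = (\<Inter>i\<in>{1..m}. {\<omega> \<in> space M. P (E i \<omega>)})"
    using pre by (rule INF_cong[OF refl])
  moreover have "\<dots> = {\<omega> \<in> space M. \<forall>i\<in>{1..m}. P (E i \<omega>)}"
  proof -
    have "1 \<in> {1..m}" using m_pos by simp
    then show ?thesis by blast
  qed
  moreover have "(\<Prod>i=1..m. prob (?Z i -` ?A \<inter> space M)) = (\<Prod>i=1..m. prob {\<omega> \<in> space M. P (E i \<omega>)})"
    using pre by (intro prod.cong refl arg_cong[where f = prob])
  ultimately show ?thesis by (simp only:)
qed

end

lemma measurable_nat_real:
  assumes "\<And>x. (\<lambda>q. g (x, q)) \<in> borel_measurable borel"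
  shows "g \<in> borel_measurable (count_space (UNIV :: nat set) \<Otimes>\<^sub>M (borel :: real measure))"
  using measurable_pair_measure_countable1[of "UNIV :: nat set" g borel borel] assms by simp

lemma h_measurable [measurable]: "h x \<in> borel_measurable borel"
  unfolding h_def by (cases "max (x - 1) 0 = 0") simp_all

section \<open>Probabilities that a given set is closed or isolated in the union\<close>

context layered_graph
begin

text \<open>The expected number of vertices that have an edge in layer \<open>i\<close>: a given
  vertex of a layer of size x is linked to another one with probability h.\<close>

definition kappa :: "nat \<Rightarrow> real" where
  "kappa i = (\<integral>\<omega>. real (X i \<omega>) * h (real (X i \<omega>)) (Q i \<omega>) \<partial>M)"

text \<open>Large sizes are cut off because the quadratic straddling bound becomes negative once x t
  exceeds 1.\<close>

definition truncated :: "real \<Rightarrow> nat \<Rightarrow> real" where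
  "truncated A i = (\<integral>\<omega>. real (X i \<omega>) * h (real (X i \<omega>)) (Q i \<omega>) * of_bool (real (X i \<omega>) \<le> A) \<partial>M)"

definition edge_mean :: "nat \<Rightarrow> real" where
  "edge_mean i = (\<integral>\<omega>. h (real (X i \<omega>)) (Q i \<omega>) \<partial>M)"

definition graph :: "'a \<Rightarrow> nat set set" where
  "graph = union_edges m E"

lemma abs_h_le: "q \<in> {0..1} \<Longrightarrow> \<bar>h (real x) q\<bar> \<le> 1"
  using h_bounds[of q x] by auto

lemma integrable_h:
  assumes i: "i \<in> {1..m}"
  shows "integrable M (\<lambda>\<omega>. h (real (X i \<omega>)) (Q i \<omega>))"
    "integrable M (\<lambda>\<omega>. real (X i \<omega>) * h (real (X i \<omega>)) (Q i \<omega>))"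
    "integrable M (\<lambda>\<omega>. real (X i \<omega>) * h (real (X i \<omega>)) (Q i \<omega>) * of_bool (real (X i \<omega>) \<le> A))"
proof -
  show "integrable M (\<lambda>\<omega>. h (real (X i \<omega>)) (Q i \<omega>))"
    using integrable_layer[OF i, of "\<lambda>(x, q). h (real x) q" 1] abs_h_le
    by (auto intro!: measurable_nat_real)
  have "\<bar>real x * h (real x) q\<bar> \<le> real n" if "x \<le> n" "q \<in> {0..1}" for x q
    using mult_mono[of "real x" "real n" "h (real x) q" 1] that h_bounds[of q x] by (auto simp: abs_mult)
  moreover have "\<bar>real x * h (real x) q * of_bool (real x \<le> A)\<bar> \<le> \<bar>real x * h (real x) q\<bar>" for x q
    by (simp add: of_bool_def)
  ultimately have b: "\<bar>real x * h (real x) q\<bar> \<le> real n" "\<bar>real x * h (real x) q * of_bool (real x \<le> A)\<bar> \<le> real n"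
      if "x \<le> n" "q \<in> {0..1}" for x q
    using that by (blast intro: order_trans)+
  show "integrable M (\<lambda>\<omega>. real (X i \<omega>) * h (real (X i \<omega>)) (Q i \<omega>))"
    using integrable_layer[OF i, of "\<lambda>(x, q). real x * h (real x) q" "real n"] b
    by (auto intro!: measurable_nat_real)
  show "integrable M (\<lambda>\<omega>. real (X i \<omega>) * h (real (X i \<omega>)) (Q i \<omega>) * of_bool (real (X i \<omega>) \<le> A))"
    using integrable_layer[OF i, of "\<lambda>(x, q). real x * h (real x) q * of_bool (real x \<le> A)" "real n"] b
    by (auto intro!: measurable_nat_real)
qed

lemma graph_closed_iff: "closed_vertices S (graph \<omega>) \<longleftrightarrow> (\<forall>i\<in>{1..m}. closed_vertices S (E i \<omega>))"
  and graph_isolated_iff: "isolated_vertices S (graph \<omega>) \<longleftrightarrow> (\<forall>i\<in>{1..m}. isolated_vertices S (E i \<omega>))"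
  by (auto simp: graph_def union_edges_def closed_vertices_def isolated_vertices_def)

text \<open>Independence gives a product over the layers, and 1 - u <= exp (-u) is applied to each
  averaged factor. The free minorant \<open>g\<close> admits both straddling bounds.\<close>

lemma prob_closed_le_exp:
  assumes S: "S \<subseteq> {1..n}"
    and g: "\<And>i. i \<in> {1..m} \<Longrightarrow> integrable M (\<lambda>\<omega>. g (X i \<omega>) (Q i \<omega>))"
    and le: "\<And>x q. x \<le> n \<Longrightarrow> q \<in> {0..1} \<Longrightarrow>
      g x q \<le> h (real x) q * (1 - (1 - real (card S) / real n) ^ x - (real (card S) / real n) ^ x)"
  shows "prob {\<omega> \<in> space M. closed_vertices S (graph \<omega>)} \<le> exp (- (\<Sum>i=1..m. \<integral>\<omega>. g (X i \<omega>) (Q i \<omega>) \<partial>M))"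
proof -
  have "prob {\<omega> \<in> space M. closed_vertices S (graph \<omega>)} =
      (\<Prod>i=1..m. prob {\<omega> \<in> space M. closed_vertices S (E i \<omega>)})"
    unfolding graph_closed_iff by (rule prob_all_edges)
  also have "\<dots> \<le> (\<Prod>i=1..m. exp (- (\<integral>\<omega>. g (X i \<omega>) (Q i \<omega>) \<partial>M)))"
  proof (rule prod_mono)
    fix i assume i: "i \<in> {1..m}"
    have "prob {\<omega> \<in> space M. closed_vertices S (E i \<omega>)} =
      (\<integral>\<omega>. measure_pmf.prob (layer_pmf n (X i \<omega>) (Q i \<omega>)) {(W, F). closed_vertices S F} \<partial>M)"
      by (rule prob_edges(2)[OF i])
    also have "\<dots> \<le> (\<integral>\<omega>. 1 - g (X i \<omega>) (Q i \<omega>) \<partial>M)"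
    proof (rule integral_mono[OF prob_edges(1)[OF i]])
      show "integrable M (\<lambda>\<omega>. 1 - g (X i \<omega>) (Q i \<omega>))" using g[OF i] by simp
      fix \<omega> assume "\<omega> \<in> space M"
      then show "measure_pmf.prob (layer_pmf n (X i \<omega>) (Q i \<omega>)) {(W, F). closed_vertices S F} \<le> 1 - g (X i \<omega>) (Q i \<omega>)"
        using prob_layer_closed_le[OF layer_range(1,2)[OF i] S] le[OF layer_range(1,2)[OF i]] by fastforce
    qed
    also have "\<dots> = 1 - (\<integral>\<omega>. g (X i \<omega>) (Q i \<omega>) \<partial>M)" using g[OF i] by (simp add: prob_space)
    also have "\<dots> \<le> exp (- (\<integral>\<omega>. g (X i \<omega>) (Q i \<omega>) \<partial>M))"
      using exp_ge_add_one_self[of "- (\<integral>\<omega>. g (X i \<omega>) (Q i \<omega>) \<partial>M)"] by simp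
    finally show "0 \<le> prob {\<omega> \<in> space M. closed_vertices S (E i \<omega>)} \<and>
      prob {\<omega> \<in> space M. closed_vertices S (E i \<omega>)} \<le> exp (- (\<integral>\<omega>. g (X i \<omega>) (Q i \<omega>) \<partial>M))" by simp
  qed
  finally show ?thesis by (simp add: exp_sum[symmetric] sum_negf)
qed

lemma card_ratio_range:
  assumes "S \<subseteq> {1..n}"
  shows "real (card S) / real n \<in> {0..1}"
  using card_mono[OF _ assms] by (auto simp: divide_le_eq_1)

lemma prob_closed_le_truncated:
  assumes S: "S \<subseteq> {1..n}"
  defines "t \<equiv> real (card S) / real n"
  shows "prob {\<omega> \<in> space M. closed_vertices S (graph \<omega>)} \<le> exp (- (t * (1 - A * t) * (\<Sum>i=1..m. truncated A i)))"
proof -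
  let ?g = "\<lambda>x q. t * (1 - A * t) * (real x * h (real x) q * of_bool (real x \<le> A))"
  have t: "t \<in> {0..1}" unfolding t_def by (rule card_ratio_range[OF S])
  have "?g x q \<le> h (real x) q * (1 - (1 - t) ^ x - t ^ x)" if q: "q \<in> {0..1}" for x q
  proof (cases "x \<ge> 2")
    case False
    then have "h (real x) q = 0" using q by (simp add: h_of_nat)
    then show ?thesis by simp
  next
    case True
    have h: "h (real x) q \<ge> 0" using h_bounds[OF q] by simp
    show ?thesis
    proof (cases "real x \<le> A")
      case True
      have "t * (1 - A * t) * real x \<le> t * (1 - real x * t) * real x"
        using True t by (intro mult_right_mono mult_left_mono diff_left_mono) auto
      also have "\<dots> \<le> 1 - (1 - t) ^ x - t ^ x"
        using straddle_prob_ge_quadratic[OF t \<open>x \<ge> 2\<close>] by (simp add: mult_ac)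
      finally have "h (real x) q * (t * (1 - A * t) * real x) \<le> h (real x) q * (1 - (1 - t) ^ x - t ^ x)"
        by (rule mult_left_mono[OF _ h])
      then show ?thesis using True by (simp add: mult_ac)
    next
      case False
      \<comment> \<open>Layers above the cutoff may be dropped since their straddling bound is
        nonnegative: the two powers sum to at most t + (1 - t).\<close>
      have "t ^ x \<le> t ^ 1" "(1 - t) ^ x \<le> (1 - t) ^ 1" using t \<open>x \<ge> 2\<close> by (intro power_decreasing; simp)+
      then show ?thesis using False h by simp
    qed
  qed
  then have "prob {\<omega> \<in> space M. closed_vertices S (graph \<omega>)} \<le> exp (- (\<Sum>i=1..m. \<integral>\<omega>. ?g (X i \<omega>) (Q i \<omega>) \<partial>M))"
    unfolding t_def
    by (intro prob_closed_le_exp[OF S, where g = "\<lambda>x q. real (card S) / real n * (1 - A * (real (card S) / real n)) *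
          (real x * h (real x) q * of_bool (real x \<le> A))"] integrable_mult_right integrable_h)
  then show ?thesis by (simp add: truncated_def sum_distrib_left)
qed

text \<open>Meant for sets of linear size, where the factor \<open>1 - A * t\<close> of the
  truncated bound may be negative.\<close>

lemma prob_closed_le_edge_mean:
  assumes S: "S \<subseteq> {1..n}" "2 * card S \<le> n"
  shows "prob {\<omega> \<in> space M. closed_vertices S (graph \<omega>)} \<le> exp (- (real (card S) / real n * (\<Sum>i=1..m. edge_mean i)))"
proof -
  define t where "t = real (card S) / real n"
  have "2 * real (card S) \<le> real n" using S(2) by linarith
  then have t: "t \<in> {0..1/2}" using card_ratio_range[OF S(1)] by (cases "n = 0") (auto simp: t_def field_simps)
  have "t * h (real x) q \<le> h (real x) q * (1 - (1 - t) ^ x - t ^ x)" if q: "q \<in> {0..1}" for x q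
  proof (cases "x \<ge> 2")
    case False
    then have "h (real x) q = 0" using q by (simp add: h_of_nat)
    then show ?thesis by simp
  next
    case True
    then show ?thesis
      using mult_left_mono[OF straddle_prob_ge_linear[OF t True], of "h (real x) q"] h_bounds[OF q, of x]
      by (simp add: mult.commute)
  qed
  then have "prob {\<omega> \<in> space M. closed_vertices S (graph \<omega>)} \<le> exp (- (\<Sum>i=1..m. \<integral>\<omega>. t * h (real (X i \<omega>)) (Q i \<omega>) \<partial>M))"
    unfolding t_def
    by (intro prob_closed_le_exp[OF S(1), where g = "\<lambda>x q. real (card S) / real n * h (real x) q"]
        integrable_mult_right integrable_h)
  then show ?thesis by (simp add: edge_mean_def sum_distrib_left t_def)
qed

lemma kappa_nonneg: "i \<in> {1..m} \<Longrightarrow> kappa i \<ge> 0"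
  unfolding kappa_def using layer_range h_bounds by (intro integral_nonneg_AE AE_I2) auto

text \<open>Each factor is at least 1 - y with y = t times the layer mean, and 1 - y >= exp (-y - 2
  y^2) requires y <= 1/2. The assumption on the sum of squares bounds every single y^2 by 1/4, so it
  secures this for all layers at once.\<close>

lemma prob_isolated_ge:
  assumes S: "S \<subseteq> {1..n}"
  defines "t \<equiv> real (card S) / real n"
  assumes small: "t\<^sup>2 * (\<Sum>i=1..m. (kappa i)\<^sup>2) \<le> 1/4"
  shows "prob {\<omega> \<in> space M. isolated_vertices S (graph \<omega>)} \<ge>
    exp (- (t * (\<Sum>i=1..m. kappa i)) - 2 * (t\<^sup>2 * (\<Sum>i=1..m. (kappa i)\<^sup>2)))"
proof -
  have t: "t \<ge> 0" by (simp add: t_def)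
  have "exp (- (t * (\<Sum>i=1..m. kappa i)) - 2 * (t\<^sup>2 * (\<Sum>i=1..m. (kappa i)\<^sup>2))) =
      (\<Prod>i=1..m. exp (- (t * kappa i) - 2 * (t * kappa i)\<^sup>2))"
    by (simp add: exp_sum[symmetric] sum_subtractf sum_negf sum_distrib_left power_mult_distrib)
  also have "\<dots> \<le> (\<Prod>i=1..m. prob {\<omega> \<in> space M. isolated_vertices S (E i \<omega>)})"
  proof (intro prod_mono conjI)
    fix i assume i: "i \<in> {1..m}"
    have "(t * kappa i)\<^sup>2 \<le> t\<^sup>2 * (\<Sum>i=1..m. (kappa i)\<^sup>2)"
      unfolding power_mult_distrib using i by (intro mult_left_mono member_le_sum) auto
    then have "(t * kappa i)\<^sup>2 \<le> (1/2)\<^sup>2" using small by (simp add: power2_eq_square)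
    then have half: "t * kappa i \<le> 1/2" by (rule power2_le_imp_le) simp
    have "- (t * kappa i) - 2 * (t * kappa i)\<^sup>2 \<le> ln (1 - t * kappa i)"
      using half t kappa_nonneg[OF i] by (intro ln_one_minus_pos_lower_bound) auto
    then have "exp (- (t * kappa i) - 2 * (t * kappa i)\<^sup>2) \<le> 1 - t * kappa i"
      using half by (simp add: ln_ge_iff[symmetric])
    also have "\<dots> = (\<integral>\<omega>. 1 - t * (real (X i \<omega>) * h (real (X i \<omega>)) (Q i \<omega>)) \<partial>M)"
      using integrable_h[OF i] by (simp add: kappa_def prob_space)
    also have "\<dots> \<le> (\<integral>\<omega>. measure_pmf.prob (layer_pmf n (X i \<omega>) (Q i \<omega>)) {(W, F). isolated_vertices S F} \<partial>M)"
      using integrable_h[OF i] prob_layer_isolated_ge[OF layer_range(1,2)[OF i] S]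
      by (intro integral_mono[OF _ prob_edges(1)[OF i]]) (auto simp: t_def)
    also have "\<dots> = prob {\<omega> \<in> space M. isolated_vertices S (E i \<omega>)}"
      by (rule prob_edges(2)[OF i, symmetric])
    finally show "exp (- (t * kappa i) - 2 * (t * kappa i)\<^sup>2) \<le> prob {\<omega> \<in> space M. isolated_vertices S (E i \<omega>)}" .
  qed simp
  also have "\<dots> = prob {\<omega> \<in> space M. isolated_vertices S (graph \<omega>)}"
    unfolding graph_isolated_iff by (rule prob_all_edges[symmetric])
  finally show ?thesis .
qed

end

text \<open>The truncated inclusion-exclusion sum differs from the indicator of N = 0 by a term of
  sign (-1)^r. Integrated over the number of isolated vertices this is Bonferroni's
  inequality.\<close>

lemma alternating_choose_sum:
  "(\<Sum>k\<le>r. (-1) ^ k * real (N choose k)) = (if N = 0 then 1 else (-1) ^ r * real ((N - 1) choose r))"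
proof (cases N)
  case 0
  have "(\<Sum>k\<le>r. (-1) ^ k * real (0 choose k)) = (\<Sum>k\<le>r. if k = 0 then 1 else 0)"
    by (intro sum.cong) (auto simp: binomial_eq_0)
  then show ?thesis using 0 by simp
next
  case (Suc M)
  have "(\<Sum>k\<le>r. (-1) ^ k * real (N choose k)) = (\<Sum>k\<le>r. (real N gchoose k) * (-1) ^ k)"
    by (simp add: binomial_gbinomial mult.commute)
  also have "\<dots> = (-1) ^ r * (real N - 1 gchoose r)" by (rule gbinomial_sum_lower_neg)
  also have "real N - 1 = real M" using Suc by simp
  finally show ?thesis using Suc by (simp add: binomial_gbinomial)
qed

lemma isolated_vertices_iff: "isolated_vertices S F \<longleftrightarrow> (\<forall>v\<in>S. isolated_vertices {v} F)"
  by (auto simp: isolated_vertices_def)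

lemma closed_singleton_iff:
  assumes "F \<subseteq> pairs U"
  shows "closed_vertices {v} F \<longleftrightarrow> isolated_vertices {v} F"
proof -
  have "\<not> e \<subseteq> {v}" if e: "e \<in> F" for e
  proof -
    obtain a b where "e = {a, b}" "a \<noteq> b" using e assms by (blast elim: pairsE)
    then show ?thesis by auto
  qed
  then show ?thesis by (auto simp: closed_vertices_def isolated_vertices_def)
qed

section \<open>Union bounds and moments for the number of closed and isolated sets\<close>

context layered_graph
begin

lemma graph_subset: "\<omega> \<in> space M \<Longrightarrow> graph \<omega> \<subseteq> pairs {1..n}"
  unfolding graph_def union_edges_def by (rule UN_least) (rule layer_range(4))

text \<open>The target is finite and discrete, so preimages of singletons suffice; equality with a
  fixed \<open>F\<close> splits into finitely many conditions on single layers.\<close>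

lemma graph_measurable: "graph \<in> measurable M (count_space (Pow (pairs {1..n})))"
proof -
  have fin: "finite (Pow (pairs {1..n}))" by (simp add: finite_pairs)
  have mem: "{\<omega> \<in> space M. P (E i \<omega>)} \<in> events" if "i \<in> {1..m}" for i P
  proof -
    have [measurable]: "P \<in> measurable (count_space (Pow (pairs {1..n}))) (count_space UNIV)" by simp
    note [measurable] = measurable_layer(4)[OF that]
    show ?thesis by measurable
  qed
  have "graph -` {F} \<inter> space M \<in> events" if F: "F \<in> Pow (pairs {1..n})" for F
  proof -
    have finF: "finite F" using F by (auto intro: finite_subset finite_pairs)
    have eq: "graph \<omega> = F \<longleftrightarrow> (\<forall>i\<in>{1..m}. E i \<omega> \<subseteq> F) \<and> (\<forall>e\<in>F. \<exists>i\<in>{1..m}. e \<in> E i \<omega>)" for \<omega>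
      unfolding graph_def union_edges_def
      by (simp only: set_eq_subset UN_subset_iff subset_eq[of F] UN_iff)
    have "graph -` {F} \<inter> space M =
      {\<omega> \<in> space M. (\<forall>i\<in>{1..m}. E i \<omega> \<subseteq> F) \<and> (\<forall>e\<in>F. \<exists>i\<in>{1..m}. e \<in> E i \<omega>)}"
      using eq by (simp only: vimage_def Int_def mem_Collect_eq singleton_iff conj_commute)
    also have "\<dots> \<in> events"
      by (intro sets.sets_Collect_conj sets.sets_Collect_finite_All sets.sets_Collect_finite_Ex
          finF finite_atLeastAtMost) (rule mem; assumption)+
    finally show ?thesis .
  qed
  then show ?thesis
    using graph_subset by (subst measurable_count_space_eq2[OF fin]) auto
qed

lemma graph_event: "{\<omega> \<in> space M. P (graph \<omega>)} \<in> events"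
proof -
  have [measurable]: "P \<in> measurable (count_space (Pow (pairs {1..n}))) (count_space UNIV)" by simp
  note [measurable] = graph_measurable
  show ?thesis by measurable
qed

lemma graph_integrable:
  fixes f :: "nat set set \<Rightarrow> real"
  shows "integrable M (\<lambda>\<omega>. f (graph \<omega>))"
proof (rule integrable_const_bound)
  show "AE \<omega> in M. norm (f (graph \<omega>)) \<le> Max ((\<lambda>F. \<bar>f F\<bar>) ` Pow (pairs {1..n}))"
    using graph_subset by (intro AE_I2) (auto intro!: Max_ge simp: finite_pairs)
  have [measurable]: "f \<in> measurable (count_space (Pow (pairs {1..n}))) borel" by simp
  note [measurable] = graph_measurable
  show "(\<lambda>\<omega>. f (graph \<omega>)) \<in> borel_measurable M" by measurable
qed

lemma graph_prob: "prob {\<omega> \<in> space M. P (graph \<omega>)} = (\<integral>\<omega>. of_bool (P (graph \<omega>)) \<partial>M)"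
proof -
  have "(\<integral>\<omega>. of_bool (P (graph \<omega>)) \<partial>M) = (\<integral>\<omega>. indicator {\<omega> \<in> space M. P (graph \<omega>)} \<omega> \<partial>M :: real)"
    by (intro Bochner_Integration.integral_cong) (auto simp: indicator_def)
  then show ?thesis using graph_event[of P] by (simp add: sets.Int_space_eq2)
qed

definition closed_sum :: "nat \<Rightarrow> real" where
  "closed_sum k = (\<Sum>S | S \<subseteq> {1..n} \<and> card S = k. prob {\<omega> \<in> space M. closed_vertices S (graph \<omega>)})"

text \<open>This is the k-th binomial moment of the number of isolated vertices.\<close>

definition isolated_sum :: "nat \<Rightarrow> real" where
  "isolated_sum k = (\<Sum>S | S \<subseteq> {1..n} \<and> card S = k. prob {\<omega> \<in> space M. isolated_vertices S (graph \<omega>)})"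

definition prob_connected :: real where
  "prob_connected = prob {\<omega> \<in> space M. graph_connected {1..n} (graph \<omega>)}"

definition prob_no_isolated :: real where
  "prob_no_isolated = prob {\<omega> \<in> space M. \<forall>v\<in>{1..n}. \<not> isolated_vertices {v} (graph \<omega>)}"

lemma card_subsets_card: "card {S. S \<subseteq> {1..n} \<and> card S = k} = n choose k"
  using n_subsets[of "{1..n}" k] by simp

lemma isolated_sum_le_closed_sum: "isolated_sum k \<le> closed_sum k"
  unfolding isolated_sum_def closed_sum_def
  by (intro sum_mono finite_measure_mono graph_event) (auto intro: isolated_imp_closed)

lemma closed_sum_le:
  assumes "\<And>S. S \<subseteq> {1..n} \<Longrightarrow> card S = k \<Longrightarrow> prob {\<omega> \<in> space M. closed_vertices S (graph \<omega>)} \<le> b"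
  shows "closed_sum k \<le> real (n choose k) * b"
proof -
  have "closed_sum k \<le> (\<Sum>S | S \<subseteq> {1..n} \<and> card S = k. b)"
    unfolding closed_sum_def using assms by (intro sum_mono) auto
  then show ?thesis unfolding sum_constant card_subsets_card .
qed

lemma isolated_sum_ge:
  assumes "\<And>S. S \<subseteq> {1..n} \<Longrightarrow> card S = k \<Longrightarrow> b \<le> prob {\<omega> \<in> space M. isolated_vertices S (graph \<omega>)}"
  shows "real (n choose k) * b \<le> isolated_sum k"
proof -
  have "(\<Sum>S | S \<subseteq> {1..n} \<and> card S = k. b) \<le> isolated_sum k"
    unfolding isolated_sum_def using assms by (intro sum_mono) auto
  then show ?thesis unfolding sum_constant card_subsets_card .
qed

lemma sum_subsets_by_card:
  fixes f :: "nat set \<Rightarrow> real"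
  assumes "finite K"
  shows "(\<Sum>S | S \<subseteq> {1..n} \<and> card S \<in> K. f S) = (\<Sum>k\<in>K. \<Sum>S | S \<subseteq> {1..n} \<and> card S = k. f S)"
proof -
  have "(\<Sum>S | S \<subseteq> {1..n} \<and> card S \<in> K. f S) =
     (\<Sum>k\<in>K. sum f {S \<in> {S. S \<subseteq> {1..n} \<and> card S \<in> K}. card S = k})"
    by (intro sum.group[symmetric] assms) auto
  also have "\<dots> = (\<Sum>k\<in>K. \<Sum>S | S \<subseteq> {1..n} \<and> card S = k. f S)"
    by (intro sum.cong) auto
  finally show ?thesis .
qed

lemma prob_connected_ge: "1 - (\<Sum>k\<in>{1..n div 2}. closed_sum k) \<le> prob_connected"
proof -
  let ?C = "\<lambda>S. {\<omega> \<in> space M. closed_vertices S (graph \<omega>)}"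
  let ?T = "{S. S \<subseteq> {1..n} \<and> card S \<in> {1..n div 2}}"
  have fin: "finite ?T" by simp
  have "1 - prob_connected = prob {\<omega> \<in> space M. \<not> graph_connected {1..n} (graph \<omega>)}"
    unfolding prob_connected_def using prob_neg[OF graph_event] by simp
  also have "\<dots> \<le> prob (\<Union>S\<in>?T. ?C S)"
  proof (intro finite_measure_mono subsetI)
    fix \<omega> assume "\<omega> \<in> {\<omega> \<in> space M. \<not> graph_connected {1..n} (graph \<omega>)}"
    then have \<omega>: "\<omega> \<in> space M" "\<not> graph_connected {1..n} (graph \<omega>)" by auto
    obtain S where S: "S \<subseteq> {1..n}" "S \<noteq> {}" "2 * card S \<le> card {1..n}" "closed_vertices S (graph \<omega>)"
      using not_connected_closed[OF graph_subset[OF \<omega>(1)] finite_atLeastAtMost \<omega>(2)] by blast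
    have "card S > 0" using S(1,2) by (meson card_gt_0_iff finite_atLeastAtMost finite_subset)
    then have "S \<in> ?T" using S by auto
    then show "\<omega> \<in> (\<Union>S\<in>?T. ?C S)" using \<omega> S by blast
  qed (use fin graph_event in auto)
  also have "\<dots> \<le> (\<Sum>S\<in>?T. prob (?C S))"
    using graph_event by (intro finite_measure_subadditive_finite fin) auto
  also have "\<dots> = (\<Sum>k\<in>{1..n div 2}. closed_sum k)"
    unfolding closed_sum_def by (rule sum_subsets_by_card) simp
  finally show ?thesis by simp
qed

text \<open>A graph on one vertex is connected although its vertex is isolated, hence the bound on
  \<open>n\<close>.\<close>

lemma prob_connected_le:
  assumes "n \<ge> 2"
  shows "prob_connected \<le> prob_no_isolated"
  unfolding prob_connected_def prob_no_isolated_def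
proof (intro finite_measure_mono graph_event subsetI)
  fix \<omega> assume \<omega>: "\<omega> \<in> {\<omega> \<in> space M. graph_connected {1..n} (graph \<omega>)}"
  have "\<not> isolated_vertices {v} (graph \<omega>)" if "v \<in> {1..n}" for v
  proof -
    obtain w where "w \<in> {1..n}" "v \<noteq> w"
    proof (cases "v = 1")
      case True then show ?thesis using that[of 2] assms by simp
    next
      case False then show ?thesis using that[of 1] assms by simp
    qed
    then show ?thesis using connected_no_isolated[of "{1..n}" "graph \<omega>" v w] \<omega> \<open>v \<in> {1..n}\<close> by blast
  qed
  then show "\<omega> \<in> {\<omega> \<in> space M. \<forall>v\<in>{1..n}. \<not> isolated_vertices {v} (graph \<omega>)}" using \<omega> by blast
qed

text \<open>If there is no isolated vertex, then the small closed set of a disconnected graph is not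
  isolated, and it has at least two vertices because a closed singleton is isolated. Isolated sets
  being closed, the event closed but not isolated has the difference of the two
  probabilities.\<close>

lemma prob_no_isolated_le_connected:
  "prob_no_isolated - prob_connected \<le> (\<Sum>k\<in>{2..n div 2}. closed_sum k - isolated_sum k)"
proof -
  let ?C = "\<lambda>S. {\<omega> \<in> space M. closed_vertices S (graph \<omega>)}"
  let ?I = "\<lambda>S. {\<omega> \<in> space M. isolated_vertices S (graph \<omega>)}"
  let ?D = "\<lambda>S. {\<omega> \<in> space M. closed_vertices S (graph \<omega>) \<and> \<not> isolated_vertices S (graph \<omega>)}"
  let ?T = "{S. S \<subseteq> {1..n} \<and> card S \<in> {2..n div 2}}"
  let ?N = "{\<omega> \<in> space M. \<forall>v\<in>{1..n}. \<not> isolated_vertices {v} (graph \<omega>)}"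
  let ?G = "{\<omega> \<in> space M. graph_connected {1..n} (graph \<omega>)}"
  have fin: "finite ?T" by simp
  have "?N \<subseteq> ?G \<union> (\<Union>S\<in>?T. ?D S)"
  proof
    fix \<omega> assume "\<omega> \<in> ?N"
    then have \<omega>: "\<omega> \<in> space M" and iso: "\<And>v. v \<in> {1..n} \<Longrightarrow> \<not> isolated_vertices {v} (graph \<omega>)" by auto
    show "\<omega> \<in> ?G \<union> (\<Union>S\<in>?T. ?D S)"
    proof (cases "graph_connected {1..n} (graph \<omega>)")
      case False
      obtain S where S: "S \<subseteq> {1..n}" "S \<noteq> {}" "2 * card S \<le> card {1..n}" "closed_vertices S (graph \<omega>)"
        using not_connected_closed[OF graph_subset[OF \<omega>] finite_atLeastAtMost False] by blast
      obtain v where v: "v \<in> S" using S(2) by blast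
      have ni: "\<not> isolated_vertices S (graph \<omega>)"
        using iso[of v] v S(1) isolated_vertices_iff[of S] by blast
      have "card S > 0" using S(1,2) by (meson card_gt_0_iff finite_atLeastAtMost finite_subset)
      moreover have "card S \<noteq> 1"
      proof
        assume "card S = 1"
        then obtain w where "S = {w}" by (auto simp: card_1_singleton_iff)
        then show False using S(4) ni closed_singleton_iff[OF graph_subset[OF \<omega>]] by simp
      qed
      ultimately have "S \<in> ?T" using S by auto
      then show ?thesis using \<omega> S ni by blast
    qed (use \<omega> in blast)
  qed
  then have "prob ?N \<le> prob (?G \<union> (\<Union>S\<in>?T. ?D S))"
    using fin graph_event by (intro finite_measure_mono sets.Un sets.finite_UN) auto
  also have "\<dots> \<le> prob ?G + prob (\<Union>S\<in>?T. ?D S)"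
    using fin graph_event by (intro measure_Un_le sets.finite_UN) auto
  also have "prob (\<Union>S\<in>?T. ?D S) \<le> (\<Sum>S\<in>?T. prob (?D S))"
    using graph_event by (intro finite_measure_subadditive_finite fin) auto
  also have "\<dots> = (\<Sum>S\<in>?T. prob (?C S) - prob (?I S))"
  proof (rule sum.cong)
    fix S
    have "?D S = ?C S - ?I S" by blast
    also have "prob \<dots> = prob (?C S) - prob (?I S)"
      by (intro finite_measure_Diff graph_event) (auto intro: isolated_imp_closed)
    finally show "prob (?D S) = prob (?C S) - prob (?I S)" .
  qed simp
  also have "\<dots> = (\<Sum>k\<in>{2..n div 2}. \<Sum>S | S \<subseteq> {1..n} \<and> card S = k. prob (?C S) - prob (?I S))"
    by (rule sum_subsets_by_card) simp
  finally show ?thesis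
    unfolding prob_no_isolated_def prob_connected_def closed_sum_def isolated_sum_def sum_subtractf by simp
qed

definition isolated_count :: "nat set set \<Rightarrow> nat" where
  "isolated_count F = card {v \<in> {1..n}. isolated_vertices {v} F}"

text \<open>A set is isolated iff each of its vertices is, so the isolated k-sets are the k-subsets
  of the set of isolated vertices.\<close>

lemma isolated_sum_eq: "isolated_sum k = (\<integral>\<omega>. real (isolated_count (graph \<omega>) choose k) \<partial>M)"
proof -
  have "isolated_sum k = (\<Sum>S | S \<subseteq> {1..n} \<and> card S = k. \<integral>\<omega>. of_bool (isolated_vertices S (graph \<omega>)) \<partial>M)"
    unfolding isolated_sum_def graph_prob ..
  also have "\<dots> = (\<integral>\<omega>. (\<Sum>S | S \<subseteq> {1..n} \<and> card S = k. of_bool (isolated_vertices S (graph \<omega>))) \<partial>M)"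
    by (rule Bochner_Integration.integral_sum[symmetric]) (rule graph_integrable)
  also have "\<dots> = (\<integral>\<omega>. real (isolated_count (graph \<omega>) choose k) \<partial>M)"
  proof (rule Bochner_Integration.integral_cong[OF refl])
    fix \<omega>
    let ?I = "{v \<in> {1..n}. isolated_vertices {v} (graph \<omega>)}"
    have "{S. S \<subseteq> {1..n} \<and> card S = k} \<inter> {S. isolated_vertices S (graph \<omega>)} = {S. S \<subseteq> ?I \<and> card S = k}"
      using isolated_vertices_iff[of _ "graph \<omega>"] by blast
    moreover have fin: "finite {S. S \<subseteq> {1..n} \<and> card S = k}" by simp
    moreover have "card {S. S \<subseteq> ?I \<and> card S = k} = isolated_count (graph \<omega>) choose k"
      unfolding isolated_count_def by (rule n_subsets) simp
    ultimately show "(\<Sum>S | S \<subseteq> {1..n} \<and> card S = k. of_bool (isolated_vertices S (graph \<omega>))) =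
      real (isolated_count (graph \<omega>) choose k)"
      unfolding sum_of_bool_eq[OF fin fin] by (simp only:)
  qed
  finally show ?thesis .
qed

lemma prob_no_isolated_eq: "prob_no_isolated = (\<integral>\<omega>. of_bool (isolated_count (graph \<omega>) = 0) \<partial>M)"
proof -
  have "(\<forall>v\<in>{1..n}. \<not> isolated_vertices {v} F) \<longleftrightarrow> isolated_count F = 0" for F
    unfolding isolated_count_def by (subst card_0_eq) auto
  then show ?thesis unfolding prob_no_isolated_def by (simp only: graph_prob[of "\<lambda>F. isolated_count F = 0"])
qed

lemma bonferroni_sum:
  "(\<Sum>k\<le>r. (-1) ^ k * isolated_sum k) = (\<integral>\<omega>. (\<Sum>k\<le>r. (-1) ^ k * real (isolated_count (graph \<omega>) choose k)) \<partial>M)"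
  unfolding isolated_sum_eq
  by (subst Bochner_Integration.integral_sum) (auto intro!: integrable_mult_right graph_integrable)

lemma bonferroni_upper:
  assumes "even r"
  shows "prob_no_isolated \<le> (\<Sum>k\<le>r. (-1) ^ k * isolated_sum k)"
  unfolding prob_no_isolated_eq bonferroni_sum
  by (rule integral_mono) (use assms in \<open>auto intro: graph_integrable simp: alternating_choose_sum\<close>)

lemma bonferroni_lower:
  assumes "odd r"
  shows "(\<Sum>k\<le>r. (-1) ^ k * isolated_sum k) \<le> prob_no_isolated"
  unfolding prob_no_isolated_eq bonferroni_sum
  by (rule integral_mono) (use assms in \<open>auto intro: graph_integrable simp: alternating_choose_sum\<close>)

text \<open>Chebyshev's argument: the indicator of N = 0 is at most (N / \<mu> - 1)^2, where \<mu>
  is the mean of N. The function \<open>?f\<close> is this square expanded in the binomial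
  coefficients of N.\<close>

lemma prob_no_isolated_second_moment:
  assumes "isolated_sum 1 > 0"
  shows "prob_no_isolated \<le> (2 * isolated_sum 2 + isolated_sum 1) / (isolated_sum 1)\<^sup>2 - 1"
proof -
  let ?N = "\<lambda>\<omega>. isolated_count (graph \<omega>)"
  let ?\<mu> = "isolated_sum 1"
  let ?f = "\<lambda>\<omega>. 2 / ?\<mu>\<^sup>2 * real (?N \<omega> choose 2) + (1 / ?\<mu>\<^sup>2 - 2 / ?\<mu>) * real (?N \<omega> choose 1) + 1"
  have lin: "(\<integral>\<omega>. a * real (?N \<omega> choose 2) + b * real (?N \<omega> choose 1) + 1 \<partial>M) =
      a * isolated_sum 2 + b * isolated_sum 1 + 1" for a b
    using graph_integrable[of "\<lambda>F. real (isolated_count F choose 2)"]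
      graph_integrable[of "\<lambda>F. real (isolated_count F choose 1)"]
    unfolding isolated_sum_eq by (simp add: prob_space)
  have "prob_no_isolated \<le> (\<integral>\<omega>. ?f \<omega> \<partial>M)"
    unfolding prob_no_isolated_eq
  proof (rule integral_mono)
    fix \<omega>
    define N where "N = ?N \<omega>"
    have two: "real (N choose 2) = real N * (real N - 1) / 2"
    proof -
      have "2 * (N choose 2) = N * (N - 1)" by (metis mult.commute choose_two dvd_div_mult_self dvd_refl even_mult_iff odd_two_times_div_two_nat)
      then have "2 * real (N choose 2) = real N * real (N - 1)" by (metis of_nat_mult of_nat_numeral)
      then show ?thesis by (cases N) auto
    qed
    have "?f \<omega> = (real N / ?\<mu> - 1)\<^sup>2"
      using assms unfolding N_def[symmetric] two by (simp add: field_simps power2_eq_square)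
    then show "of_bool (?N \<omega> = 0) \<le> ?f \<omega>" unfolding N_def[symmetric] by (cases "N = 0") auto
  qed (rule graph_integrable)+
  also have "\<dots> = 2 / ?\<mu>\<^sup>2 * isolated_sum 2 + (1 / ?\<mu>\<^sup>2 - 2 / ?\<mu>) * isolated_sum 1 + 1"
    by (rule lin)
  also have "\<dots> = (2 * isolated_sum 2 + isolated_sum 1) / ?\<mu>\<^sup>2 - 1"
    using assms by (simp add: field_simps power2_eq_square)
  finally show ?thesis .
qed

lemma truncated_bounds:
  assumes i: "i \<in> {1..m}" and A: "A \<ge> 0"
  shows "0 \<le> truncated A i" "truncated A i \<le> A" "truncated A i \<le> kappa i" "kappa i \<le> real n"
proof -
  have h: "0 \<le> h (real (X i \<omega>)) (Q i \<omega>)" "h (real (X i \<omega>)) (Q i \<omega>) \<le> 1" if "\<omega> \<in> space M" for \<omega>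
    using h_bounds layer_range(2)[OF i that] by auto
  show "0 \<le> truncated A i"
    unfolding truncated_def using h by (intro integral_nonneg_AE AE_I2) auto
  have "truncated A i \<le> (\<integral>\<omega>. A \<partial>M)"
    unfolding truncated_def
  proof (rule integral_mono[OF integrable_h(3)[OF i]])
    fix \<omega> assume \<omega>: "\<omega> \<in> space M"
    show "real (X i \<omega>) * h (real (X i \<omega>)) (Q i \<omega>) * of_bool (real (X i \<omega>) \<le> A) \<le> A"
      using mult_mono[of "real (X i \<omega>)" A "h (real (X i \<omega>)) (Q i \<omega>)" 1] h[OF \<omega>] A by auto
  qed simp
  then show "truncated A i \<le> A" by (simp add: prob_space)
  show "truncated A i \<le> kappa i"
    unfolding truncated_def kappa_def using h
    by (intro integral_mono integrable_h i) (auto simp: of_bool_def)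
  have "kappa i \<le> (\<integral>\<omega>. real n \<partial>M)"
    unfolding kappa_def
  proof (rule integral_mono[OF integrable_h(2)[OF i]])
    fix \<omega> assume \<omega>: "\<omega> \<in> space M"
    show "real (X i \<omega>) * h (real (X i \<omega>)) (Q i \<omega>) \<le> real n"
      using mult_mono[of "real (X i \<omega>)" "real n" "h (real (X i \<omega>)) (Q i \<omega>)" 1] h[OF \<omega>] layer_range(1)[OF i \<omega>] by auto
  qed simp
  then show "kappa i \<le> real n" by (simp add: prob_space)
qed

text \<open>Each layer mean is split as a + b with a <= A from small sizes and b <= n from the rest,
  and (a + b)^2 <= 2 a^2 + 2 b^2. Only the total of the parts b is small, so one factor b is bounded
  by n and the other is kept for summation.\<close>

lemma sum_kappa_squares_le:
  assumes A: "A \<ge> 0"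
  shows "(\<Sum>i=1..m. (kappa i)\<^sup>2) \<le> 2 * A * (\<Sum>i=1..m. kappa i) + 2 * real n * (\<Sum>i=1..m. kappa i - truncated A i)"
proof -
  have "(kappa i)\<^sup>2 \<le> 2 * A * kappa i + 2 * real n * (kappa i - truncated A i)" if i: "i \<in> {1..m}" for i
  proof -
    define a where "a = truncated A i"
    define b where "b = kappa i - truncated A i"
    have ab: "0 \<le> a" "a \<le> A" "0 \<le> b" "b \<le> real n" "kappa i = a + b" "a \<le> kappa i"
      using truncated_bounds[OF i A] by (auto simp: a_def b_def)
    have "(a + b)\<^sup>2 \<le> 2 * (a * a) + 2 * (b * b)"
      using zero_le_power2[of "a - b"] by (simp add: power2_eq_square algebra_simps)
    moreover have "a * a \<le> A * kappa i" "b * b \<le> real n * b"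
      using ab A by (intro mult_mono; simp)+
    ultimately show ?thesis unfolding ab(5) a_def[symmetric] b_def[symmetric] by simp
  qed
  then have "(\<Sum>i=1..m. (kappa i)\<^sup>2) \<le> (\<Sum>i=1..m. 2 * A * kappa i + 2 * real n * (kappa i - truncated A i))"
    by (intro sum_mono) auto
  then show ?thesis by (simp only: sum.distrib sum_distrib_left)
qed

lemma isolated_sum_nonneg: "0 \<le> isolated_sum k"
  unfolding isolated_sum_def by (intro sum_nonneg) auto

end

section \<open>Uniform integrability\<close>

locale limit_law =
  fixes M :: "nat \<Rightarrow> 'a measure" and Xs :: "nat \<Rightarrow> 'a \<Rightarrow> nat" and Qs :: "nat \<Rightarrow> 'a \<Rightarrow> real"
    and N :: "'b measure" and X' :: "'b \<Rightarrow> nat" and Q' :: "'b \<Rightarrow> real"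
  assumes prob_M: "n \<ge> 1 \<Longrightarrow> prob_space (M n)"
    and Xs_measurable: "n \<ge> 1 \<Longrightarrow> Xs n \<in> measurable (M n) (count_space UNIV)"
    and Qs_measurable: "n \<ge> 1 \<Longrightarrow> Qs n \<in> borel_measurable (M n)"
    and Xs_le: "n \<ge> 1 \<Longrightarrow> \<omega> \<in> space (M n) \<Longrightarrow> Xs n \<omega> \<le> n"
    and Qs_range: "n \<ge> 1 \<Longrightarrow> \<omega> \<in> space (M n) \<Longrightarrow> Qs n \<omega> \<in> {0..1}"
    and prob_N: "prob_space N"
    and X'_measurable: "X' \<in> measurable N (count_space UNIV)"
    and Q'_measurable: "Q' \<in> borel_measurable N"
    and Q'_range: "\<And>\<omega>. \<omega> \<in> space N \<Longrightarrow> Q' \<omega> \<in> {0..1}"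
    and conv: "converges_in_distribution M (\<lambda>n \<omega>. (real (Xs n \<omega>), Qs n \<omega>)) N
                 (\<lambda>\<omega>. (real (X' \<omega>), Q' \<omega>))"
    and nontrivial: "(\<integral>\<omega>. Q' \<omega> * indicator {\<omega>. X' \<omega> \<ge> 2} \<omega> \<partial>N) > 0"
    and moment: "integrable N (\<lambda>\<omega>. real (X' \<omega>) * h (real (X' \<omega>)) (Q' \<omega>) * ln (1 + real (X' \<omega>)))"
    and moment_conv:
      "(\<lambda>n. \<integral>\<omega>. real (Xs n \<omega>) * h (real (Xs n \<omega>)) (Qs n \<omega>) * ln (1 + real (Xs n \<omega>)) \<partial>M n)
         \<longlonglongrightarrow> (\<integral>\<omega>. real (X' \<omega>) * h (real (X' \<omega>)) (Q' \<omega>) * ln (1 + real (X' \<omega>)) \<partial>N)"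
begin

text \<open>All moments needed have a weight depending on the size alone. Since h vanishes for sizes
  0 and 1, only the values of \<open>c\<close> from 2 on matter.\<close>

definition mean :: "nat \<Rightarrow> (nat \<Rightarrow> real) \<Rightarrow> real" where
  "mean n c = (\<integral>\<omega>. c (Xs n \<omega>) * h (real (Xs n \<omega>)) (Qs n \<omega>) \<partial>M n)"

definition lim_mean :: "(nat \<Rightarrow> real) \<Rightarrow> real" where
  "lim_mean c = (\<integral>\<omega>. c (X' \<omega>) * h (real (X' \<omega>)) (Q' \<omega>) \<partial>N)"

lemma h_pair_measurable [measurable]:
  "(\<lambda>z. c (fst z) * h (real (fst z)) (snd z)) \<in> borel_measurable (count_space UNIV \<Otimes>\<^sub>M borel)"
  by (rule measurable_nat_real) simp

lemma mean_integrable: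
  assumes n: "n \<ge> 1"
  shows "integrable (M n) (\<lambda>\<omega>. c (Xs n \<omega>) * h (real (Xs n \<omega>)) (Qs n \<omega>))"
proof -
  interpret prob_space "M n" by (rule prob_M[OF n])
  note [measurable] = Xs_measurable[OF n] Qs_measurable[OF n]
  show ?thesis
  proof (rule integrable_const_bound)
    have "\<bar>c (Xs n \<omega>) * h (real (Xs n \<omega>)) (Qs n \<omega>)\<bar> \<le> Max ((\<lambda>x. \<bar>c x\<bar>) ` {..n})" if "\<omega> \<in> space (M n)" for \<omega>
    proof -
      have "\<bar>c (Xs n \<omega>) * h (real (Xs n \<omega>)) (Qs n \<omega>)\<bar> \<le> \<bar>c (Xs n \<omega>)\<bar>"
        using h_bounds[OF Qs_range[OF n that], of "Xs n \<omega>"] by (simp add: abs_mult mult_left_le)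
      also have "\<dots> \<le> Max ((\<lambda>x. \<bar>c x\<bar>) ` {..n})"
        using Xs_le[OF n that] by (intro Max_ge) auto
      finally show ?thesis .
    qed
    then show "AE \<omega> in M n. norm (c (Xs n \<omega>) * h (real (Xs n \<omega>)) (Qs n \<omega>)) \<le> Max ((\<lambda>x. \<bar>c x\<bar>) ` {..n})"
      by (intro AE_I2) simp
    have "(\<lambda>\<omega>. (\<lambda>z. c (fst z) * h (real (fst z)) (snd z)) (Xs n \<omega>, Qs n \<omega>)) \<in> borel_measurable (M n)"
      by measurable
    then show "(\<lambda>\<omega>. c (Xs n \<omega>) * h (real (Xs n \<omega>)) (Qs n \<omega>)) \<in> borel_measurable (M n)"
      by simp
  qed
qed

lemma h_zero: "q \<in> {0..1} \<Longrightarrow> \<not> 2 \<le> x \<Longrightarrow> h (real x) q = 0"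
  by (simp add: h_of_nat)

lemma mean_mono:
  assumes "n \<ge> 1" "\<And>x. x \<ge> 2 \<Longrightarrow> c x \<le> d x"
  shows "mean n c \<le> mean n d"
  unfolding mean_def
proof (rule integral_mono[OF mean_integrable mean_integrable])
  fix \<omega> assume \<omega>: "\<omega> \<in> space (M n)"
  show "c (Xs n \<omega>) * h (real (Xs n \<omega>)) (Qs n \<omega>) \<le> d (Xs n \<omega>) * h (real (Xs n \<omega>)) (Qs n \<omega>)"
    using assms(2) h_bounds[OF Qs_range[OF assms(1) \<omega>]] h_zero[OF Qs_range[OF assms(1) \<omega>], of "Xs n \<omega>"]
    by (cases "2 \<le> Xs n \<omega>") (auto intro: mult_right_mono)
qed (use assms in auto)

lemma mean_diff: "n \<ge> 1 \<Longrightarrow> mean n (\<lambda>x. c x - d x) = mean n c - mean n d"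
  unfolding mean_def left_diff_distrib by (rule Bochner_Integration.integral_diff; rule mean_integrable)

lemma mean_scale: "mean n (\<lambda>x. a * c x) = a * mean n c"
  unfolding mean_def mult.assoc by simp

lemma mean_truncated_tendsto:
  fixes A :: nat
  shows "(\<lambda>n. mean n (\<lambda>x. c x * of_bool (x \<le> A))) \<longlonglongrightarrow> lim_mean (\<lambda>x. c x * of_bool (x \<le> A))"
proof -
  \<comment> \<open>Weak convergence is tested by bounded continuous functions on the plane, but the
    integrand is given on integer sizes. A tent of width one around each j is the indicator of j on
    the integers, and clamping the second coordinate to [0, 1] keeps the polynomial in it
    bounded.\<close>
  define F :: "real \<times> real \<Rightarrow> real" where
    "F z = (\<Sum>j\<le>A. max 0 (1 - \<bar>fst z - real j\<bar>) * (c j * (1 - (1 - max 0 (min 1 (snd z))) ^ (j - 1))))" for z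
  have F: "F (real x, q) = c x * of_bool (x \<le> A) * h (real x) q" if q: "q \<in> {0..1}" for x q
  proof -
    have *: "max 0 (1 - \<bar>real x - real j\<bar>) = of_bool (x = j)" for j
    proof (cases "x = j")
      case False
      then have "\<bar>real x - real j\<bar> \<ge> 1" by (cases "x < j") auto
      then show ?thesis using False by simp
    qed simp
    have q': "max 0 (min 1 q) = q" using q by auto
    have "F (real x, q) = (\<Sum>j\<le>A. if x = j then c j * (1 - (1 - q) ^ (j - 1)) else 0)"
      unfolding F_def fst_conv snd_conv * q' by (intro sum.cong) auto
    also have "\<dots> = c x * of_bool (x \<le> A) * h (real x) q"
      using h_of_nat[OF q, of x] by (simp add: sum.delta')
    finally show ?thesis .
  qed
  have cont: "continuous_on UNIV F"
    unfolding F_def by (intro continuous_intros)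
  have bnd: "bounded (range F)"
  proof (rule boundedI)
    fix y assume "y \<in> range F"
    then obtain z where y: "y = F z" by auto
    have "\<bar>F z\<bar> \<le> (\<Sum>j\<le>A. \<bar>max 0 (1 - \<bar>fst z - real j\<bar>) * (c j * (1 - (1 - max 0 (min 1 (snd z))) ^ (j - 1)))\<bar>)"
      unfolding F_def by (rule sum_abs)
    also have "\<dots> \<le> (\<Sum>j\<le>A. 1 * (\<bar>c j\<bar> * 1))"
      unfolding abs_mult
    proof (intro sum_mono mult_mono)
      fix j
      have "(1 - max 0 (min 1 (snd z))) ^ (j - 1) \<le> 1" "0 \<le> (1 - max 0 (min 1 (snd z))) ^ (j - 1)"
        by (auto intro!: power_le_one zero_le_power)
      then show "\<bar>1 - (1 - max 0 (min 1 (snd z))) ^ (j - 1)\<bar> \<le> 1" by simp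
    qed auto
    finally show "norm y \<le> (\<Sum>j\<le>A. 1 * (\<bar>c j\<bar> * 1))" using y by simp
  qed
  have "(\<lambda>n. \<integral>\<omega>. F (real (Xs n \<omega>), Qs n \<omega>) \<partial>M n) \<longlonglongrightarrow> (\<integral>\<omega>. F (real (X' \<omega>), Q' \<omega>) \<partial>N)"
    using conv cont bnd unfolding converges_in_distribution_def by blast
  moreover have "(\<integral>\<omega>. F (real (X' \<omega>), Q' \<omega>) \<partial>N) = lim_mean (\<lambda>x. c x * of_bool (x \<le> A))"
    unfolding lim_mean_def using F Q'_range by (intro Bochner_Integration.integral_cong) auto
  moreover have "(\<integral>\<omega>. F (real (Xs n \<omega>), Qs n \<omega>) \<partial>M n) = mean n (\<lambda>x. c x * of_bool (x \<le> A))" if "n \<ge> 1" for n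
    unfolding mean_def using F Qs_range[OF that] by (intro Bochner_Integration.integral_cong) auto
  then have "\<forall>\<^sub>F n in sequentially. (\<integral>\<omega>. F (real (Xs n \<omega>), Qs n \<omega>) \<partial>M n) = mean n (\<lambda>x. c x * of_bool (x \<le> A))"
    by (rule eventually_sequentiallyI)
  ultimately show ?thesis by (simp add: tendsto_cong)
qed

abbreviation (input) xlog :: "nat \<Rightarrow> real" where
  "xlog x \<equiv> real x * ln (1 + real x)"

lemma mean_xlog_tendsto: "(\<lambda>n. mean n xlog) \<longlonglongrightarrow> lim_mean xlog"
  using moment_conv unfolding mean_def lim_mean_def by (simp add: mult_ac)

lemma lim_mean_measurable: "(\<lambda>\<omega>. c (X' \<omega>) * h (real (X' \<omega>)) (Q' \<omega>)) \<in> borel_measurable N"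
proof -
  note [measurable] = X'_measurable Q'_measurable
  have "(\<lambda>\<omega>. (\<lambda>z. c (fst z) * h (real (fst z)) (snd z)) (X' \<omega>, Q' \<omega>)) \<in> borel_measurable N"
    by measurable
  then show ?thesis by simp
qed

lemma lim_mean_truncated_tendsto:
  assumes int: "integrable N (\<lambda>\<omega>. c (X' \<omega>) * h (real (X' \<omega>)) (Q' \<omega>))"
  shows "(\<lambda>A. lim_mean (\<lambda>x. c x * of_bool (x \<le> A))) \<longlonglongrightarrow> lim_mean c"
  unfolding lim_mean_def
proof (rule integral_dominated_convergence)
  show "integrable N (\<lambda>\<omega>. norm (c (X' \<omega>) * h (real (X' \<omega>)) (Q' \<omega>)))"
    using int by (rule integrable_norm)
  show "AE \<omega> in N. (\<lambda>A. c (X' \<omega>) * of_bool (X' \<omega> \<le> A) * h (real (X' \<omega>)) (Q' \<omega>))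
      \<longlonglongrightarrow> c (X' \<omega>) * h (real (X' \<omega>)) (Q' \<omega>)"
  proof (rule AE_I2)
    fix \<omega>
    have "\<forall>\<^sub>F A in sequentially. c (X' \<omega>) * h (real (X' \<omega>)) (Q' \<omega>) =
        c (X' \<omega>) * of_bool (X' \<omega> \<le> A) * h (real (X' \<omega>)) (Q' \<omega>)"
      by (rule eventually_sequentiallyI[of "X' \<omega>"]) simp
    then show "(\<lambda>A. c (X' \<omega>) * of_bool (X' \<omega> \<le> A) * h (real (X' \<omega>)) (Q' \<omega>))
      \<longlonglongrightarrow> c (X' \<omega>) * h (real (X' \<omega>)) (Q' \<omega>)"
      by (rule Lim_transform_eventually[OF tendsto_const])
  qed
  show "(\<lambda>\<omega>. c (X' \<omega>) * of_bool (X' \<omega> \<le> A) * h (real (X' \<omega>)) (Q' \<omega>)) \<in> borel_measurable N" for A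
    by (rule lim_mean_measurable)
qed (auto simp: lim_mean_measurable of_bool_def)

text \<open>Uniform integrability from convergence of means: the full and the truncated means both
  converge, hence so do the tails, and the tail of the limit law is below \<epsilon> for a suitable
  cutoff.\<close>

lemma tail_xlog_le:
  assumes "\<epsilon> > 0"
  shows "\<exists>A. \<forall>\<^sub>F n in sequentially. mean n (\<lambda>x. xlog x * of_bool (A < x)) \<le> \<epsilon>"
proof -
  have "(\<lambda>A. lim_mean (\<lambda>x. xlog x * of_bool (x \<le> A))) \<longlonglongrightarrow> lim_mean xlog"
    using moment by (intro lim_mean_truncated_tendsto) (simp add: mult_ac)
  then have "\<forall>\<^sub>F A in sequentially. lim_mean xlog - \<epsilon> < lim_mean (\<lambda>x. xlog x * of_bool (x \<le> A))"
    using assms by (intro order_tendstoD) auto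
  then obtain A where A: "lim_mean xlog - \<epsilon> < lim_mean (\<lambda>x. xlog x * of_bool (x \<le> A))"
    by (auto simp: eventually_sequentially)
  have "(\<lambda>n. mean n xlog - mean n (\<lambda>x. xlog x * of_bool (x \<le> A))) \<longlonglongrightarrow>
      lim_mean xlog - lim_mean (\<lambda>x. xlog x * of_bool (x \<le> A))"
    by (intro tendsto_diff mean_xlog_tendsto mean_truncated_tendsto)
  then have "\<forall>\<^sub>F n in sequentially. mean n xlog - mean n (\<lambda>x. xlog x * of_bool (x \<le> A)) < \<epsilon>"
    using A by (intro order_tendstoD) auto
  then have "\<forall>\<^sub>F n in sequentially. mean n (\<lambda>x. xlog x * of_bool (A < x)) \<le> \<epsilon>"
    using eventually_ge_at_top[of 1]
  proof eventually_elim
    case (elim n)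
    have "mean n (\<lambda>x. xlog x * of_bool (A < x)) = mean n (\<lambda>x. xlog x - xlog x * of_bool (x \<le> A))"
      by (intro arg_cong[where f = "mean n"] ext) (auto simp: of_bool_def)
    then show ?case using elim mean_diff[of n] by simp
  qed
  then show ?thesis by blast
qed

definition tail :: "nat \<Rightarrow> real \<Rightarrow> real" where
  "tail n A = mean n (\<lambda>x. real x * of_bool (A < real x))"

lemma tail_nonneg: "n \<ge> 1 \<Longrightarrow> tail n A \<ge> 0"
  using mean_mono[of n "\<lambda>_. 0" "\<lambda>x. real x * of_bool (A < real x)"] by (simp add: tail_def mean_def)

text \<open>Because e <= 3. It lets \<open>xlog\<close> dominate the size wherever h is
  nonzero.\<close>

lemma ln_one_plus_ge_1: "x \<ge> 2 \<Longrightarrow> ln (1 + real x) \<ge> 1"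
  using ln_ge_iff[of "1 + real x" 1] exp_le by (auto intro: order_trans)

lemma tail_le:
  assumes "\<epsilon> > 0"
  shows "\<exists>A. \<forall>\<^sub>F n in sequentially. tail n (real A) \<le> \<epsilon>"
proof -
  obtain A where A: "\<forall>\<^sub>F n in sequentially. mean n (\<lambda>x. xlog x * of_bool (A < x)) \<le> \<epsilon>"
    using tail_xlog_le[OF assms] by blast
  have "\<forall>\<^sub>F n in sequentially. tail n (real A) \<le> \<epsilon>"
    using A eventually_ge_at_top[of 1]
  proof eventually_elim
    case (elim n)
    have "tail n (real A) \<le> mean n (\<lambda>x. xlog x * of_bool (A < x))"
      unfolding tail_def using ln_one_plus_ge_1 elim(2)
      by (intro mean_mono mult_right_mono) (auto simp: mult_le_cancel_left1)
    then show ?case using elim by simp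
  qed
  then show ?thesis by blast
qed

text \<open>The logarithm in the moment condition is spent here: for x > sqrt n one has ln (1 + x)
  >= (ln n) / 2, so (ln n) / 2 times the tail is at most an \<open>xlog\<close> tail with fixed
  cutoff.\<close>

lemma tail_sqrt_ln_tendsto: "(\<lambda>n. tail n (sqrt (real n)) * ln (real n)) \<longlonglongrightarrow> 0"
proof (rule tendstoI)
  fix \<epsilon> :: real assume \<epsilon>: "\<epsilon> > 0"
  obtain A where A: "\<forall>\<^sub>F n in sequentially. mean n (\<lambda>x. xlog x * of_bool (A < x)) \<le> \<epsilon> / 4"
    using tail_xlog_le[of "\<epsilon> / 4"] \<epsilon> by auto
  show "\<forall>\<^sub>F n in sequentially. dist (tail n (sqrt (real n)) * ln (real n)) 0 < \<epsilon>"
    using A eventually_ge_at_top[of "max 2 (A\<^sup>2)"]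
  proof eventually_elim
    case (elim n)
    then have n: "n \<ge> 1" "n \<ge> 2" and "A\<^sup>2 \<le> n" by auto
    then have "(real A)\<^sup>2 \<le> real n" by (metis of_nat_mono of_nat_power)
    then have An: "real A \<le> sqrt (real n)" by (simp add: real_le_rsqrt)
    have ln: "ln (real n) > 0" using n by simp
    have "ln (real n) / 2 * tail n (sqrt (real n)) = mean n (\<lambda>x. ln (real n) / 2 * (real x * of_bool (sqrt (real n) < real x)))"
      unfolding tail_def by (rule mean_scale[symmetric])
    also have "\<dots> \<le> mean n (\<lambda>x. xlog x * of_bool (A < x))"
    proof (rule mean_mono[OF n(1)])
      fix x :: nat assume x: "x \<ge> 2"
      show "ln (real n) / 2 * (real x * of_bool (sqrt (real n) < real x)) \<le> xlog x * of_bool (A < x)"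
      proof (cases "sqrt (real n) < real x")
        case True
        then have "A < x" using An by linarith
        have "ln (real n) / 2 = ln (sqrt (real n))" using n by (simp add: ln_sqrt)
        also have "\<dots> \<le> ln (1 + real x)" using True n by (intro ln_mono) auto
        finally show ?thesis using True \<open>A < x\<close> by (simp add: mult.commute mult_left_mono)
      next
        case False
        then show ?thesis using ln_one_plus_ge_1[OF x] by (simp add: of_bool_def)
      qed
    qed
    also have "\<dots> \<le> \<epsilon> / 4" by (rule elim)
    finally show ?case using tail_nonneg[OF n(1)] ln \<epsilon> by (simp add: abs_mult mult.commute)
  qed
qed

lemma mean_id_bounded: "\<exists>K>0. \<forall>\<^sub>F n in sequentially. mean n real \<le> K"
proof (intro exI conjI)
  show "max 1 (lim_mean xlog + 1) > 0" by simp
  have "\<forall>\<^sub>F n in sequentially. mean n xlog < lim_mean xlog + 1"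
    by (rule order_tendstoD[OF mean_xlog_tendsto]) simp
  then show "\<forall>\<^sub>F n in sequentially. mean n real \<le> max 1 (lim_mean xlog + 1)"
    using eventually_ge_at_top[of 1]
  proof eventually_elim
    case (elim n)
    have "mean n real \<le> mean n xlog"
      using ln_one_plus_ge_1 elim by (intro mean_mono) (auto simp: mult_le_cancel_left1)
    then show ?case using elim by simp
  qed
qed

text \<open>For x >= 2 one has h(x, q) >= q, so the nontriviality assumption makes the limiting mean
  of h positive. A finite truncation of it is already positive and passes to the mixture
  means.\<close>

lemma mean_one_bounded_below: "\<exists>a>0. \<forall>\<^sub>F n in sequentially. a \<le> mean n (\<lambda>_. 1)"
proof -
  interpret N: prob_space N by (rule prob_N)
  have hb: "integrable N (\<lambda>\<omega>. 1 * h (real (X' \<omega>)) (Q' \<omega>))"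
  proof (rule N.integrable_const_bound[where B = 1])
    show "AE \<omega> in N. norm (1 * h (real (X' \<omega>)) (Q' \<omega>)) \<le> 1"
      using h_bounds[OF Q'_range] by (intro AE_I2) simp
    show "(\<lambda>\<omega>. 1 * h (real (X' \<omega>)) (Q' \<omega>)) \<in> borel_measurable N" by (rule lim_mean_measurable)
  qed
  have "(\<integral>\<omega>. Q' \<omega> * indicator {\<omega>. X' \<omega> \<ge> 2} \<omega> \<partial>N) \<le> lim_mean (\<lambda>_. 1)"
    unfolding lim_mean_def
  proof (rule integral_mono'[OF hb])
    fix \<omega> assume "\<omega> \<in> space N"
    then have q: "Q' \<omega> \<in> {0..1}" by (rule Q'_range)
    show "Q' \<omega> * indicator {\<omega>. X' \<omega> \<ge> 2} \<omega> \<le> 1 * h (real (X' \<omega>)) (Q' \<omega>)"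
    proof (cases "X' \<omega> \<ge> 2")
      case True
      have "(1 - Q' \<omega>) ^ (X' \<omega> - 1) \<le> (1 - Q' \<omega>) ^ 1"
        using True q by (intro power_decreasing) auto
      then show ?thesis using True h_of_nat[OF q, of "X' \<omega>"] by simp
    qed (use h_bounds[OF q] in simp)
    show "0 \<le> 1 * h (real (X' \<omega>)) (Q' \<omega>)" using h_bounds[OF q] by simp
  qed
  then have pos: "lim_mean (\<lambda>_. 1) > 0" using nontrivial by linarith
  have "(\<lambda>A. lim_mean (\<lambda>x. 1 * of_bool (x \<le> A))) \<longlonglongrightarrow> lim_mean (\<lambda>_. 1)"
    by (rule lim_mean_truncated_tendsto[OF hb])
  then have "\<forall>\<^sub>F A in sequentially. 0 < lim_mean (\<lambda>x. 1 * of_bool (x \<le> A))"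
    using pos by (intro order_tendstoD) auto
  then obtain A where A: "0 < lim_mean (\<lambda>x. 1 * of_bool (x \<le> A))"
    by (auto simp: eventually_sequentially)
  have "\<forall>\<^sub>F n in sequentially. lim_mean (\<lambda>x. 1 * of_bool (x \<le> A)) / 2 < mean n (\<lambda>x. 1 * of_bool (x \<le> A))"
    using A by (intro order_tendstoD(1)[OF mean_truncated_tendsto]) auto
  then have "\<forall>\<^sub>F n in sequentially. lim_mean (\<lambda>x. 1 * of_bool (x \<le> A)) / 2 \<le> mean n (\<lambda>_. 1)"
    using eventually_ge_at_top[of 1]
  proof eventually_elim
    case (elim n)
    have "mean n (\<lambda>x. 1 * of_bool (x \<le> A)) \<le> mean n (\<lambda>_. 1)" using elim by (intro mean_mono) auto
    then show ?case using elim by simp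
  qed
  then show ?thesis using A by (intro exI[of _ "lim_mean (\<lambda>x. 1 * of_bool (x \<le> A)) / 2"]) auto
qed

lemma mean_one_le_mean_id: "n \<ge> 1 \<Longrightarrow> mean n (\<lambda>_. 1) \<le> mean n real"
  by (rule mean_mono) auto

end

section \<open>Asymptotics\<close>

lemma choose_div_power_tendsto: "(\<lambda>n. real (n choose k) / real n ^ k) \<longlonglongrightarrow> 1 / fact k"
proof (induction k)
  case (Suc k)
  have "(\<lambda>n. (1 - real k / real n) / (real k + 1)) \<longlonglongrightarrow> (1 - 0) / (real k + 1)"
    by (intro tendsto_intros lim_const_over_n) auto
  from tendsto_mult[OF Suc this]
  have "(\<lambda>n. real (n choose k) / real n ^ k * ((1 - real k / real n) / (real k + 1))) \<longlonglongrightarrow> 1 / fact (Suc k)"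
    by (simp add: field_simps)
  moreover have "\<forall>\<^sub>F n in sequentially. real (n choose k) / real n ^ k * ((1 - real k / real n) / (real k + 1)) =
      real (n choose Suc k) / real n ^ Suc k"
    using eventually_gt_at_top[of 0] by eventually_elim (simp add: real_choose_Suc field_simps)
  ultimately show ?case by (rule Lim_transform_eventually)
qed simp

lemma choose_le_power_div_fact: "real (n choose k) \<le> real n ^ k / fact k"
proof -
  have "real ((n choose k) * fact k) \<le> real (n ^ k)"
    using binomial_fact_pow by (rule of_nat_mono)
  then show ?thesis by (simp add: field_simps)
qed

text \<open>\<open>k ^ k / fact k\<close> is one term of the series for exp k. This yields the
  estimate (e n / k)^k for n choose k.\<close>

lemma power_self_le_exp_fact: "real k ^ k \<le> exp (real k) * fact k"
proof -
  have "sum (\<lambda>j. real k ^ j /\<^sub>R fact j) {k} \<le> exp (real k)"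
    unfolding exp_def by (rule sum_le_suminf[OF summable_exp_generic]) auto
  then show ?thesis by (simp add: field_simps)
qed

lemma sum_power_div_fact_le:
  fixes x :: real
  assumes "finite S" "x \<ge> 0" "0 \<notin> S"
  shows "(\<Sum>k\<in>S. x ^ k / fact k) \<le> exp x - 1"
proof -
  have "sum (\<lambda>j. x ^ j /\<^sub>R fact j) (insert 0 S) \<le> exp x"
    unfolding exp_def using assms by (intro sum_le_suminf[OF summable_exp_generic]) auto
  then show ?thesis using assms by (simp add: divide_inverse mult.commute)
qed

lemma ln_ge_eventually: "\<forall>\<^sub>F n in sequentially. x \<le> ln (real n)"
  using filterlim_compose[OF ln_at_top filterlim_real_sequentially] by (auto simp: filterlim_at_top)

text \<open>Collects the probabilistic input as inequalities between real sequences, so that the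
  rest is calculus. In the application \<open>\<mu> n\<close> is m / n, \<open>\<eta> n\<close> is
  the mean of h, \<open>\<tau> n A\<close> is the part of \<open>\<kappa> n\<close> from sizes above
  \<open>A\<close>, \<open>s n\<close> is the sum of the squared layer means over n^2,
  \<open>CL n k\<close> and \<open>IS n k\<close> are the expected numbers of closed and isolated
  k-sets, and \<open>p n\<close> and \<open>p0 n\<close> are the probabilities of connectedness and
  of having no isolated vertex.\<close>

locale threshold =
  fixes \<mu> \<kappa> \<eta> s lam p p0 :: "nat \<Rightarrow> real" and \<tau> :: "nat \<Rightarrow> real \<Rightarrow> real" and CL IS :: "nat \<Rightarrow> nat \<Rightarrow> real"
  assumes mu_nonneg: "\<And>n. \<mu> n \<ge> 0"
    and lam_eq: "\<And>n. lam n = ln (real n) - \<mu> n * \<kappa> n"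
    and tau_bounds: "\<And>n A. n \<ge> 2 \<Longrightarrow> 0 \<le> \<tau> n A \<and> \<tau> n A \<le> \<kappa> n"
    and eta_le: "\<And>n. n \<ge> 2 \<Longrightarrow> \<eta> n \<le> \<kappa> n"
    and s_bounds: "\<And>n. n \<ge> 2 \<Longrightarrow> 0 \<le> s n \<and> s n \<le> 2 * (\<mu> n * \<kappa> n) / sqrt (real n) + 2 * (\<mu> n * \<tau> n (sqrt (real n)))"
    and IS_le_CL: "\<And>n k. n \<ge> 2 \<Longrightarrow> IS n k \<le> CL n k"
    and CL_le_tau: "\<And>n k A. n \<ge> 2 \<Longrightarrow> 
      CL n k \<le> real (n choose k) * exp (- (real k * (1 - A * (real k / real n)) * (\<mu> n * (\<kappa> n - \<tau> n A))))"
    and CL_le_eta: "\<And>n k. n \<ge> 2 \<Longrightarrow> 2 * k \<le> n \<Longrightarrow> CL n k \<le> real (n choose k) * exp (- (real k * (\<mu> n * \<eta> n)))"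
    and IS_ge: "\<And>n k. n \<ge> 2 \<Longrightarrow> (real k)\<^sup>2 * s n \<le> 1/4 \<Longrightarrow>
      real (n choose k) * exp (- (real k * (\<mu> n * \<kappa> n)) - 2 * ((real k)\<^sup>2 * s n)) \<le> IS n k"
    and IS_nonneg: "\<And>n k. n \<ge> 2 \<Longrightarrow> 0 \<le> IS n k"
    and p_ge: "\<And>n. n \<ge> 2 \<Longrightarrow> 1 - (\<Sum>k\<in>{1..n div 2}. CL n k) \<le> p n"
    and p_bounds: "\<And>n. n \<ge> 2 \<Longrightarrow> 0 \<le> p n \<and> p n \<le> p0 n \<and> p0 n \<le> 1"
    and p0_p: "\<And>n. n \<ge> 2 \<Longrightarrow> p0 n - p n \<le> (\<Sum>k\<in>{2..n div 2}. CL n k - IS n k)"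
    and bonferroni_even: "\<And>n r. n \<ge> 2 \<Longrightarrow> even r \<Longrightarrow> p0 n \<le> (\<Sum>k\<le>r. (-1) ^ k * IS n k)"
    and bonferroni_odd: "\<And>n r. n \<ge> 2 \<Longrightarrow> odd r \<Longrightarrow> (\<Sum>k\<le>r. (-1) ^ k * IS n k) \<le> p0 n"
    and second_moment: "\<And>n. n \<ge> 2 \<Longrightarrow> IS n 1 > 0 \<Longrightarrow> p0 n \<le> (2 * IS n 2 + IS n 1) / (IS n 1)\<^sup>2 - 1"
    and tau_sqrt: "(\<lambda>n. \<tau> n (sqrt (real n)) * ln (real n)) \<longlonglongrightarrow> 0"
    and tau_small: "\<And>\<epsilon>. \<epsilon> > 0 \<Longrightarrow> \<exists>A. A \<ge> 0 \<and> (\<forall>\<^sub>F n in sequentially. \<tau> n A \<le> \<epsilon>)"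
    and kappa_bounded: "\<exists>K>0. \<forall>\<^sub>F n in sequentially. \<kappa> n \<le> K"
    and eta_bounded_below: "\<exists>a>0. \<forall>\<^sub>F n in sequentially. a \<le> \<eta> n"
begin

text \<open>The loss per vertex in the exponent at cutoff sqrt n: the first term comes from the
  dropped large layers, and n^(-1/4) is the value of A k / n at A = sqrt n and k = n^(1/4).\<close>

definition err :: "nat \<Rightarrow> real" where
  "err n = \<mu> n * (\<tau> n (sqrt (real n)) + real n powr (-1/4) * \<kappa> n)"

definition D :: "nat \<Rightarrow> real" where
  "D n = exp (lam n + err n)"

lemma CL_le_D:
  assumes n: "n \<ge> 2" and k: "real k \<le> real n powr (1/4)"
  shows "CL n k \<le> real (n choose k) / real n ^ k * D n ^ k"
proof -
  let ?t = "\<tau> n (sqrt (real n))" and ?\<epsilon> = "real n powr (-1/4)"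
  have b: "0 \<le> ?t" "?t \<le> \<kappa> n" using tau_bounds[OF n] by auto
  have "sqrt (real n) * (real k / real n) \<le> real n powr (1/2) * (real n powr (1/4) / real n powr 1)"
    using k n by (intro mult_mono) (auto simp: powr_half_sqrt intro!: divide_right_mono)
  also have "\<dots> = ?\<epsilon>" using n powr_diff[of "real n" "3/4" 1] by (simp add: powr_add[symmetric])
  finally have "(1 - ?\<epsilon>) * (\<kappa> n - ?t) \<le> (1 - sqrt (real n) * (real k / real n)) * (\<kappa> n - ?t)"
    using b by (intro mult_right_mono) auto
  moreover have "\<kappa> n - (?t + ?\<epsilon> * \<kappa> n) \<le> (1 - ?\<epsilon>) * (\<kappa> n - ?t)"
    using b by (simp add: algebra_simps)
  ultimately have "\<kappa> n - (?t + ?\<epsilon> * \<kappa> n) \<le> (1 - sqrt (real n) * (real k / real n)) * (\<kappa> n - ?t)" by linarith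
  then have "(real k * \<mu> n) * (\<kappa> n - (?t + ?\<epsilon> * \<kappa> n)) \<le>
      (real k * \<mu> n) * ((1 - sqrt (real n) * (real k / real n)) * (\<kappa> n - ?t))"
    using mu_nonneg[of n] by (intro mult_left_mono) auto
  moreover have "(real k * \<mu> n) * (\<kappa> n - (?t + ?\<epsilon> * \<kappa> n)) = - (real k * (lam n + err n) - real k * ln (real n))"
    unfolding lam_eq err_def by (simp add: algebra_simps)
  ultimately have "- (real k * (1 - sqrt (real n) * (real k / real n)) * (\<mu> n * (\<kappa> n - ?t))) \<le>
      real k * (lam n + err n) - real k * ln (real n)"
    by (simp add: mult_ac)
  then have "exp (- (real k * (1 - sqrt (real n) * (real k / real n)) * (\<mu> n * (\<kappa> n - ?t)))) \<le>
      exp (real k * (lam n + err n) - real k * ln (real n))"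
    by simp
  also have "\<dots> = D n ^ k / real n ^ k"
    using n by (simp add: exp_diff D_def exp_of_nat_mult)
  finally have "exp (- (real k * (1 - sqrt (real n) * (real k / real n)) * (\<mu> n * (\<kappa> n - ?t)))) \<le> D n ^ k / real n ^ k" .
  then have "real (n choose k) * exp (- (real k * (1 - sqrt (real n) * (real k / real n)) * (\<mu> n * (\<kappa> n - ?t)))) \<le>
      real (n choose k) * (D n ^ k / real n ^ k)"
    by (rule mult_left_mono) simp
  then show ?thesis using CL_le_tau[OF n, of k "sqrt (real n)"] by simp
qed

lemma CL_le_D_fact:
  assumes n: "n \<ge> 2" and k: "real k \<le> real n powr (1/4)"
  shows "CL n k \<le> D n ^ k / fact k"
proof -
  have "real (n choose k) / real n ^ k \<le> 1 / fact k"
    using choose_le_power_div_fact[of n k] n by (simp add: field_simps)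
  then have "real (n choose k) / real n ^ k * D n ^ k \<le> 1 / fact k * D n ^ k"
    by (rule mult_right_mono) (simp add: D_def)
  then show ?thesis using CL_le_D[OF n k] by simp
qed

text \<open>For n^(1/4) < k <= \<beta> n the binomial coefficient costs at most 1 + 3/4 ln n per
  vertex, while the fixed cutoff \<open>A\<close> leaves at least 7/8 (ln n - C); the gap of (ln n)
  / 8 decides. For larger k the binomial coefficient is at most 2^n, and the exponent is at least a
  large multiple of n because \<mu> grows without bound.\<close>

lemma CL_large:
  assumes lam: "\<forall>\<^sub>F n in sequentially. lam n \<le> C"
  shows "\<forall>\<^sub>F n in sequentially. \<forall>k. real n powr (1/4) < real k \<longrightarrow> 2 * k \<le> n \<longrightarrow> CL n k \<le> exp (- (real n powr (1/4)))"
proof -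
  obtain K where K: "K > 0" "\<forall>\<^sub>F n in sequentially. \<kappa> n \<le> K" using kappa_bounded by blast
  obtain a where a: "a > 0" "\<forall>\<^sub>F n in sequentially. a \<le> \<eta> n" using eta_bounded_below by blast
  obtain A where A: "A \<ge> 0" "\<forall>\<^sub>F n in sequentially. \<tau> n A \<le> a / 16" using tau_small[of "a / 16"] a by auto
  \<comment> \<open>This makes \<open>A * (k / n)\<close> at most 1/16 on the first range; together
    with \<tau> <= a / 16 <= \<kappa> / 16 each loss is a factor 15/16.\<close>
  define \<beta> where "\<beta> = 1 / (16 * (A + 1))"
  have \<beta>: "\<beta> > 0" "A * \<beta> \<le> 1/16" using A(1) by (auto simp: \<beta>_def field_simps)
  \<comment> \<open>The first threshold on ln n ensures ln n >= C and 1 + 7/8 C - (ln n) / 8 <= -1.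
    The second forces \<beta> \<mu> a >= ln 2 + 1, which beats 2^n with a factor exp (-n) to
    spare.\<close>
  show ?thesis
    using lam K(2) a(2) A(2) eventually_ge_at_top[of 2] ln_ge_eventually[of "max C (16 + 7 * C)"]
      ln_ge_eventually[of "C + (ln 2 + 1) * K / (\<beta> * a)"]
  proof eventually_elim
    case (elim n)
    have n: "n \<ge> 2" and kap: "a \<le> \<kappa> n" using elim eta_le[of n] by auto
    have n0: "real n > 0" using n by simp
    have mu: "\<mu> n \<ge> 0" by (rule mu_nonneg)
    have L: "\<mu> n * \<kappa> n \<ge> ln (real n) - C" "ln (real n) - C \<ge> 0" using elim lam_eq[of n] by auto
    show ?case
    proof (intro allI impI)
      fix k assume k: "real n powr (1/4) < real k" "2 * k \<le> n"
      have k0: "real k > 0" using k(1) powr_ge_zero[of "real n" "1/4"] by linarith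
      show "CL n k \<le> exp (- (real n powr (1/4)))"
      proof (cases "real k \<le> \<beta> * real n")
        case True
        have "real n / real k \<le> real n / real n powr (1/4)"
          using k(1) k0 n0 by (intro divide_left_mono mult_pos_pos) auto
        also have "\<dots> = real n powr (1 - 1/4)" using n0 powr_diff[of "real n" 1 "1/4"] by simp
        also have "\<dots> = exp (3/4 * ln (real n))" using n0 by (simp add: powr_def)
        finally have nk: "real n / real k \<le> exp (3/4 * ln (real n))" .
        have "real (n choose k) \<le> real n ^ k / fact k" by (rule choose_le_power_div_fact)
        also have "\<dots> \<le> exp (real k) * (real n / real k) ^ k"
          using power_self_le_exp_fact[of k] k0 n0
          by (simp add: power_divide field_simps mult_left_mono)
        also have "\<dots> \<le> exp (real k) * exp (3/4 * ln (real n)) ^ k"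
          using nk n0 k0 by (intro mult_left_mono power_mono) auto
        also have "\<dots> = exp (real k * (1 + 3/4 * ln (real n)))"
          by (simp add: exp_add[symmetric] exp_of_nat_mult[symmetric] algebra_simps)
        finally have choose: "real (n choose k) \<le> exp (real k * (1 + 3/4 * ln (real n)))" .
        have "A * (real k / real n) \<le> A * \<beta>"
          using True A(1) n0 by (intro mult_left_mono) (auto simp: field_simps)
        then have f1: "15/16 \<le> 1 - A * (real k / real n)" using \<beta>(2) by linarith
        have f2: "15/16 * \<kappa> n \<le> \<kappa> n - \<tau> n A" using elim kap by simp
        \<comment> \<open>The square of 15/16 is 225/256, just above 7/8 = 224/256.\<close>
        have "7/8 * x \<le> 225/256 * y" if "x \<le> y" "0 \<le> x" for x y :: real
          using that by linarith
        from this[OF L] have "7/8 * (ln (real n) - C) \<le> 15/16 * (\<mu> n * (15/16 * \<kappa> n))" by simp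
        also have "\<dots> \<le> (1 - A * (real k / real n)) * (\<mu> n * (\<kappa> n - \<tau> n A))"
          using f1 order_trans[OF _ f1, of 0] f2 mu kap a(1)
          by (intro mult_mono mult_left_mono mult_nonneg_nonneg) auto
        finally have "real k * (7/8 * (ln (real n) - C)) \<le>
           real k * ((1 - A * (real k / real n)) * (\<mu> n * (\<kappa> n - \<tau> n A)))"
          using k0 by (intro mult_left_mono) auto
        then have "exp (- (real k * (1 - A * (real k / real n)) * (\<mu> n * (\<kappa> n - \<tau> n A)))) \<le>
            exp (- (real k * (7/8 * (ln (real n) - C))))" by (simp add: mult.assoc)
        with choose have "real (n choose k) * exp (- (real k * (1 - A * (real k / real n)) * (\<mu> n * (\<kappa> n - \<tau> n A)))) \<le>
            exp (real k * (1 + 3/4 * ln (real n))) * exp (- (real k * (7/8 * (ln (real n) - C))))"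
          by (intro mult_mono) auto
        also have "\<dots> = exp (real k * (1 + 7/8 * C - ln (real n) / 8))"
          unfolding exp_add[symmetric] by (rule arg_cong[where f = exp]) (simp add: field_simps)
        also have "\<dots> \<le> exp (real k * (-1))"
          using elim k0 by (subst exp_le_cancel_iff, intro mult_left_mono) auto
        also have "\<dots> \<le> exp (- (real n powr (1/4)))" using k(1) by simp
        finally show ?thesis using CL_le_tau[OF n, of k A] by linarith
      next
        case False
        have "ln (real n) - C \<le> \<mu> n * K"
          using L elim mu mult_left_mono[of "\<kappa> n" K "\<mu> n"] by linarith
        moreover have "(ln 2 + 1) * K / (\<beta> * a) \<le> ln (real n) - C" using elim by simp
        ultimately have "(ln 2 + 1) * K / (\<beta> * a) \<le> \<mu> n * K" by linarith
        then have "(ln 2 + 1) * K \<le> \<mu> n * K * (\<beta> * a)" using \<beta>(1) a(1) by (subst (asm) pos_divide_le_eq) auto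
        then have "(ln 2 + 1) * K \<le> \<beta> * (\<mu> n * a) * K" by (simp add: mult_ac)
        then have mb: "ln 2 + 1 \<le> \<beta> * (\<mu> n * a)" using K(1) by (rule mult_right_le_imp_le)
        have "real n * (ln 2 + 1) \<le> real n * (\<beta> * (\<mu> n * a))" using mb n0 by (intro mult_left_mono) auto
        also have "\<dots> = (\<beta> * real n) * (\<mu> n * a)" by simp
        also have "\<dots> \<le> real k * (\<mu> n * \<eta> n)"
          using False mu elim a(1) \<beta>(1) by (intro mult_mono mult_left_mono) auto
        finally have ex: "real n * (ln 2 + 1) \<le> real k * (\<mu> n * \<eta> n)" .
        have "real (n choose k) \<le> real (2 ^ n)" by (rule of_nat_mono[OF binomial_le_pow2])
        also have "\<dots> = exp (real n * ln 2)" by (simp add: exp_of_nat_mult)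
        finally have "real (n choose k) * exp (- (real k * (\<mu> n * \<eta> n))) \<le> exp (real n * ln 2) * exp (- (real n * (ln 2 + 1)))"
          using ex by (intro mult_mono) auto
        also have "\<dots> = exp (- real n)" by (simp add: exp_add[symmetric] algebra_simps)
        also have "\<dots> \<le> exp (- (real n powr (1/4)))"
          using powr_mono[of "1/4" 1 "real n"] n by simp
        finally show ?thesis using CL_le_eta[OF n k(2)] by linarith
      qed
    qed
  qed
qed

definition small :: "nat \<Rightarrow> nat set" where
  "small n = {k \<in> {1..n div 2}. real k \<le> real n powr (1/4)}"

definition large :: "nat \<Rightarrow> nat set" where
  "large n = {k \<in> {1..n div 2}. real n powr (1/4) < real k}"

lemma small_large: "finite (small n)" "finite (large n)" "{1..n div 2} = small n \<union> large n" "small n \<inter> large n = {}"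
  by (auto simp: small_def large_def)

lemma large_sum_le:
  assumes lam: "\<forall>\<^sub>F n in sequentially. lam n \<le> C"
  shows "\<forall>\<^sub>F n in sequentially. (\<Sum>k\<in>large n. CL n k) \<le> real n * exp (- (real n powr (1/4)))"
  using CL_large[OF lam]
proof eventually_elim
  case (elim n)
  have "(\<Sum>k\<in>large n. CL n k) \<le> (\<Sum>k\<in>large n. exp (- (real n powr (1/4))))"
    using elim by (intro sum_mono) (auto simp: large_def)
  also have "\<dots> = real (card (large n)) * exp (- (real n powr (1/4)))" by simp
  also have "card (large n) \<le> n"
  proof -
    have "card (large n) \<le> card {1..n}" by (rule card_mono) (auto simp: large_def)
    then show ?thesis by simp
  qed
  then have "real (card (large n)) * exp (- (real n powr (1/4))) \<le> real n * exp (- (real n powr (1/4)))"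
    by (intro mult_right_mono) auto
  finally show ?case .
qed

lemma large_bound_tendsto: "(\<lambda>n. real n * exp (- (real n powr (1/4)))) \<longlonglongrightarrow> 0"
  by real_asymp


lemma err_nonneg: "n \<ge> 2 \<Longrightarrow> 0 \<le> err n"
  unfolding err_def using tau_bounds[of n "sqrt (real n)"] mu_nonneg[of n]
  by (intro mult_nonneg_nonneg add_nonneg_nonneg) auto

text \<open>The errors are bounded relative to the exponent ln n - lam n, which equals \<mu>
  \<kappa>, because that exponent is not O(ln n) when lam tends to minus infinity. Since \<kappa> >=
  a, replacing \<mu> by \<mu> \<kappa> / a costs only a constant.\<close>

lemma err_rate:
  obtains r where "(\<lambda>n. r n * ln (real n)) \<longlonglongrightarrow> 0"
    and "\<forall>\<^sub>F n in sequentially. 0 \<le> r n \<and> err n \<le> (ln (real n) - lam n) * r n \<and>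
      \<mu> n * \<tau> n (sqrt (real n)) \<le> (ln (real n) - lam n) * r n"
proof -
  obtain a where a: "a > 0" "\<forall>\<^sub>F n in sequentially. a \<le> \<eta> n" using eta_bounded_below by blast
  define r where "r n = \<tau> n (sqrt (real n)) / a + real n powr (-1/4)" for n
  have "(\<lambda>n. \<tau> n (sqrt (real n)) * ln (real n) / a + real n powr (-1/4) * ln (real n)) \<longlonglongrightarrow> 0 / a + 0"
  proof (intro tendsto_add tendsto_divide tau_sqrt tendsto_const)
    show "(\<lambda>n. real n powr (-1/4) * ln (real n)) \<longlonglongrightarrow> 0" by real_asymp
  qed (use a in auto)
  then have "(\<lambda>n. r n * ln (real n)) \<longlonglongrightarrow> 0" by (simp add: r_def algebra_simps)
  moreover have "\<forall>\<^sub>F n in sequentially. 0 \<le> r n \<and> err n \<le> (ln (real n) - lam n) * r n \<and>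
      \<mu> n * \<tau> n (sqrt (real n)) \<le> (ln (real n) - lam n) * r n"
    using a(2) eventually_ge_at_top[of 2]
  proof eventually_elim
    case (elim n)
    let ?t = "\<tau> n (sqrt (real n))"
    have t: "0 \<le> ?t" "?t \<le> \<kappa> n" and mu: "0 \<le> \<mu> n" and ak: "a \<le> \<kappa> n"
      using tau_bounds elim mu_nonneg eta_le[of n] by auto
    have "\<mu> n * ?t = (\<mu> n * a) * (?t / a)" using a(1) by simp
    also have "\<dots> \<le> (\<mu> n * \<kappa> n) * (?t / a)"
      using t mu ak a(1) by (intro mult_right_mono mult_left_mono) auto
    finally have *: "\<mu> n * ?t \<le> (ln (real n) - lam n) * (?t / a)" by (simp add: lam_eq)
    have **: "\<mu> n * (real n powr (-1/4) * \<kappa> n) = (ln (real n) - lam n) * real n powr (-1/4)"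
      by (simp add: lam_eq)
    have "0 \<le> (ln (real n) - lam n) * real n powr (-1/4)"
      using mu ak a(1) by (simp add: lam_eq)
    moreover have "0 \<le> (ln (real n) - lam n) * (?t / a)"
      using t mu ak a(1) by (simp add: lam_eq)
    moreover have "0 \<le> ?t / a + real n powr (-1/4)" using t a(1) by simp
    ultimately show ?case unfolding err_def r_def distrib_left ** using * by linarith
  qed
  ultimately show ?thesis by (rule that)
qed

lemma rate_le:
  assumes "(\<lambda>n. r n * ln (real n)) \<longlonglongrightarrow> 0" "\<forall>\<^sub>F n in sequentially. 0 \<le> r n"
  shows "\<forall>\<^sub>F n in sequentially. r n * ln (real n) < 1/2 \<and> r n < 1/2"
proof -
  have "\<forall>\<^sub>F n in sequentially. r n * ln (real n) < 1/2"
    using assms(1) by (intro order_tendstoD) auto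
  then show ?thesis using assms(2) ln_ge_eventually[of 1]
  proof eventually_elim
    case (elim n)
    then have "r n * 1 \<le> r n * ln (real n)" by (intro mult_left_mono) auto
    then show ?case using elim by simp
  qed
qed

text \<open>Nothing forces \<open>err\<close> to tend to 0 here. But r n <= 1/2 eventually, so it
  consumes at most half of -lam n plus a bounded amount; hence \<open>D\<close> tends to 0, and the
  small sets contribute at most exp (D n) - 1.\<close>

lemma connected_whp:
  assumes lam: "filterlim lam at_bot sequentially"
  shows "p \<longlonglongrightarrow> 1"
proof -
  obtain r where r: "(\<lambda>n. r n * ln (real n)) \<longlonglongrightarrow> 0"
    "\<forall>\<^sub>F n in sequentially. 0 \<le> r n \<and> err n \<le> (ln (real n) - lam n) * r n \<and>
      \<mu> n * \<tau> n (sqrt (real n)) \<le> (ln (real n) - lam n) * r n"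
    by (rule err_rate)
  have r0: "\<forall>\<^sub>F n in sequentially. 0 \<le> r n" using r(2) by eventually_elim simp
  have lam0: "\<forall>\<^sub>F n in sequentially. lam n \<le> 0" using lam by (simp add: filterlim_at_bot)
  have D_le: "\<forall>\<^sub>F n in sequentially. D n \<le> exp (lam n / 2 + 1)"
    using r(2) rate_le[OF r(1) r0] lam0
  proof eventually_elim
    case (elim n)
    have "lam n + err n \<le> lam n * (1 - r n) + r n * ln (real n)" using elim by (simp add: algebra_simps)
    moreover have "lam n * (1 - r n) \<le> lam n * (1/2)" using elim by (intro mult_left_mono_neg) auto
    ultimately have "lam n + err n \<le> lam n / 2 + 1" using elim by simp
    then show ?case by (simp add: D_def)
  qed
  have "filterlim (\<lambda>n. lam n / 2 + 1) at_bot sequentially"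
    unfolding filterlim_at_bot
  proof
    fix Z
    have "\<forall>\<^sub>F n in sequentially. lam n \<le> 2 * (Z - 1)" using lam by (simp add: filterlim_at_bot)
    then show "\<forall>\<^sub>F n in sequentially. lam n / 2 + 1 \<le> Z" by eventually_elim simp
  qed
  then have "(\<lambda>n. exp (lam n / 2 + 1)) \<longlonglongrightarrow> 0" by (rule filterlim_compose[OF exp_at_bot])
  then have D0: "D \<longlonglongrightarrow> 0"
    using D_le by (intro tendsto_sandwich[of "\<lambda>_. 0" D _ "\<lambda>n. exp (lam n / 2 + 1)"]) (auto simp: D_def)
  have lower: "(\<lambda>n. 1 - (exp (D n) - 1 + real n * exp (- (real n powr (1/4))))) \<longlonglongrightarrow> 1 - (exp 0 - 1 + 0)"
    by (intro tendsto_intros D0 large_bound_tendsto)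
  have "\<forall>\<^sub>F n in sequentially. 1 - (exp (D n) - 1 + real n * exp (- (real n powr (1/4)))) \<le> p n"
    using large_sum_le[OF lam0] eventually_ge_at_top[of 2]
  proof eventually_elim
    case (elim n)
    have "(\<Sum>k\<in>small n. CL n k) \<le> (\<Sum>k\<in>small n. D n ^ k / fact k)"
      using CL_le_D_fact[OF elim(2)] by (intro sum_mono) (auto simp: small_def)
    also have "\<dots> \<le> exp (D n) - 1"
      by (intro sum_power_div_fact_le) (auto simp: small_def D_def)
    finally have "(\<Sum>k\<in>small n. CL n k) \<le> exp (D n) - 1" .
    moreover have "(\<Sum>k\<in>{1..n div 2}. CL n k) = (\<Sum>k\<in>small n. CL n k) + (\<Sum>k\<in>large n. CL n k)"
      unfolding small_large(3) by (rule sum.union_disjoint) (use small_large in auto)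
    ultimately show ?case using p_ge[OF elim(2)] elim(1) by linarith
  qed
  moreover have "\<forall>\<^sub>F n in sequentially. p n \<le> 1"
    using eventually_ge_at_top[of 2] by eventually_elim (use p_bounds in fastforce)
  ultimately show ?thesis
    using lower by (intro tendsto_sandwich[of _ p _ "\<lambda>_. 1"]) auto
qed

text \<open>A lower bound on lam makes the exponent O(ln n), so relative errors of size o(1 / ln n)
  become o(1). The remaining part of \<open>s\<close> is O(ln n / sqrt n).\<close>

lemma err_s_tendsto:
  assumes lam: "\<forall>\<^sub>F n in sequentially. - C \<le> lam n"
  shows "err \<longlonglongrightarrow> 0" "s \<longlonglongrightarrow> 0"
proof -
  define B where "B = max C 0"
  have B: "B \<ge> 0" "C \<le> B" by (auto simp: B_def)
  obtain r where r: "(\<lambda>n. r n * ln (real n)) \<longlonglongrightarrow> 0"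
    "\<forall>\<^sub>F n in sequentially. 0 \<le> r n \<and> err n \<le> (ln (real n) - lam n) * r n \<and>
      \<mu> n * \<tau> n (sqrt (real n)) \<le> (ln (real n) - lam n) * r n"
    by (rule err_rate)
  have lim: "(\<lambda>n. (1 + B) * (r n * ln (real n))) \<longlonglongrightarrow> 0"
    using tendsto_mult[OF tendsto_const[of "1 + B"] r(1)] by simp
  have le: "\<forall>\<^sub>F n in sequentially. err n \<le> (1 + B) * (r n * ln (real n)) \<and>
      \<mu> n * \<tau> n (sqrt (real n)) \<le> (1 + B) * (r n * ln (real n)) \<and> ln (real n) - lam n \<le> (1 + B) * ln (real n)"
    using r(2) lam ln_ge_eventually[of 1]
  proof eventually_elim
    case (elim n)
    have "B * 1 \<le> B * ln (real n)" using elim B by (intro mult_left_mono) auto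
    then have L: "ln (real n) - lam n \<le> (1 + B) * ln (real n)" using elim B(2) by (simp add: algebra_simps)
    then have "(ln (real n) - lam n) * r n \<le> (1 + B) * ln (real n) * r n"
      using elim by (intro mult_right_mono) auto
    then show ?case using elim L by (simp add: mult_ac)
  qed
  show "err \<longlonglongrightarrow> 0"
  proof (rule tendsto_sandwich[OF _ _ tendsto_const lim])
    show "\<forall>\<^sub>F n in sequentially. 0 \<le> err n"
      using eventually_ge_at_top[of 2] by eventually_elim (rule err_nonneg)
    show "\<forall>\<^sub>F n in sequentially. err n \<le> (1 + B) * (r n * ln (real n))"
      using le by eventually_elim simp
  qed
  have "(\<lambda>n. 2 * (1 + B) * (ln (real n) / sqrt (real n)) + 2 * ((1 + B) * (r n * ln (real n)))) \<longlonglongrightarrow>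
      2 * (1 + B) * 0 + 2 * 0"
  proof (intro tendsto_add tendsto_mult tendsto_const lim)
    show "(\<lambda>n. ln (real n) / sqrt (real n)) \<longlonglongrightarrow> 0" by real_asymp
  qed
  then have lim2: "(\<lambda>n. 2 * (1 + B) * (ln (real n) / sqrt (real n)) + 2 * ((1 + B) * (r n * ln (real n)))) \<longlonglongrightarrow> 0"
    by simp
  show "s \<longlonglongrightarrow> 0"
  proof (rule tendsto_sandwich[OF _ _ tendsto_const lim2])
    show "\<forall>\<^sub>F n in sequentially. 0 \<le> s n"
      using eventually_ge_at_top[of 2] by eventually_elim (use s_bounds in blast)
    show "\<forall>\<^sub>F n in sequentially. s n \<le> 2 * (1 + B) * (ln (real n) / sqrt (real n)) + 2 * ((1 + B) * (r n * ln (real n)))"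
      using le eventually_ge_at_top[of 2]
    proof eventually_elim
      case (elim n)
      have "2 * (\<mu> n * \<kappa> n) / sqrt (real n) \<le> 2 * ((1 + B) * ln (real n)) / sqrt (real n)"
        using elim by (intro divide_right_mono) (auto simp: lam_eq)
      also have "\<dots> = 2 * (1 + B) * (ln (real n) / sqrt (real n))" by simp
      finally show ?case using s_bounds[OF elim(2)] elim(1) by linarith
    qed
  qed
qed

lemma IS_ge_lam:
  assumes n: "n \<ge> 2" "(real k)\<^sup>2 * s n \<le> 1/4"
  shows "real (n choose k) / real n ^ k * exp (real k * lam n - 2 * ((real k)\<^sup>2 * s n)) \<le> IS n k"
proof -
  have "real n ^ k = exp (real k * ln (real n))" using n by (simp add: exp_of_nat_mult)
  then have "exp (real k * lam n - 2 * ((real k)\<^sup>2 * s n)) =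
      exp (- (real k * (\<mu> n * \<kappa> n)) - 2 * ((real k)\<^sup>2 * s n)) * real n ^ k"
    by (simp add: lam_eq exp_add[symmetric] algebra_simps)
  then show ?thesis using IS_ge[OF n] n by simp
qed

lemma small_s_eventually:
  assumes "s \<longlonglongrightarrow> 0"
  shows "\<forall>\<^sub>F n in sequentially. (real k)\<^sup>2 * s n \<le> 1/4"
proof -
  have "(\<lambda>n. (real k)\<^sup>2 * s n) \<longlonglongrightarrow> (real k)\<^sup>2 * 0" by (intro tendsto_intros assms)
  then have "\<forall>\<^sub>F n in sequentially. (real k)\<^sup>2 * s n < 1/4" by (intro order_tendstoD) auto
  then show ?thesis by eventually_elim simp
qed

lemma small_k_eventually: "\<forall>\<^sub>F n in sequentially. real k \<le> real n powr (1/4)"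
proof -
  have "filterlim (\<lambda>n. real n powr (1/4)) at_top sequentially" by real_asymp
  then show ?thesis by (simp add: filterlim_at_top)
qed

text \<open>In the second moment bound the unbounded factor exp (lam n) cancels from the quotient D
  / y, leaving exp (2 err + 4 s), which tends to 1 and is offset by the -1. The other term 1 / y is
  of order exp (- lam n).\<close>

lemma disconnected_whp:
  assumes lam: "filterlim lam at_top sequentially"
  shows "p \<longlonglongrightarrow> 0"
proof -
  have "\<forall>\<^sub>F n in sequentially. - 0 \<le> lam n" using lam by (simp add: filterlim_at_top)
  note es = err_s_tendsto[OF this]
  have "filterlim (\<lambda>n. - lam n) at_bot sequentially" using lam by (simp add: filterlim_uminus_at_bot)
  then have exp0: "(\<lambda>n. exp (- lam n)) \<longlonglongrightarrow> 0" by (rule filterlim_compose[OF exp_at_bot])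
  have upper: "(\<lambda>n. exp (2 * err n + 4 * s n) + exp (- lam n) * exp (2 * s n) - 1) \<longlonglongrightarrow> exp (2 * 0 + 4 * 0) + 0 * exp (2 * 0) - 1"
    by (intro tendsto_intros es exp0)
  have "\<forall>\<^sub>F n in sequentially. p n \<le> exp (2 * err n + 4 * s n) + exp (- lam n) * exp (2 * s n) - 1"
    using small_s_eventually[OF es(2), of 1] small_k_eventually[of 2] eventually_ge_at_top[of 2]
  proof eventually_elim
    case (elim n)
    define I where "I = IS n 1"
    define y where "y = exp (lam n - 2 * s n)"
    have y: "0 < y" "y \<le> I" using IS_ge_lam[of n 1] elim by (auto simp: y_def I_def)
    have "IS n 2 \<le> D n ^ 2 / fact 2"
      using IS_le_CL[of n 2] CL_le_D_fact[of n 2] elim by linarith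
    then have I2: "2 * IS n 2 \<le> (D n)\<^sup>2" by (simp add: fact_2)
    have "p n \<le> (2 * IS n 2 + I) / I\<^sup>2 - 1"
      using second_moment[of n] p_bounds[of n] elim y by (fastforce simp: I_def)
    also have "\<dots> \<le> ((D n)\<^sup>2 + I) / I\<^sup>2 - 1"
      using I2 by (intro diff_right_mono divide_right_mono) auto
    also have "\<dots> = (D n / I)\<^sup>2 + 1 / I - 1"
      using y by (simp add: field_simps power2_eq_square)
    also have "\<dots> \<le> (D n / y)\<^sup>2 + 1 / y - 1"
      using y by (intro diff_right_mono add_mono power_mono divide_left_mono) (auto simp: D_def)
    also have "\<dots> = exp (2 * err n + 4 * s n) + exp (- lam n) * exp (2 * s n) - 1"
      unfolding D_def y_def
      by (simp add: exp_diff[symmetric] exp_minus[symmetric] inverse_eq_divide[symmetric] power2_eq_square exp_add[symmetric] algebra_simps)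
    finally show ?case .
  qed
  moreover have "\<forall>\<^sub>F n in sequentially. 0 \<le> p n"
    using eventually_ge_at_top[of 2] by eventually_elim (use p_bounds in blast)
  ultimately show ?thesis
    using upper by (intro tendsto_sandwich[of "\<lambda>_. 0" p]) auto
qed

section \<open>The critical window\<close>

context
  fixes c :: real
  assumes lam_c: "lam \<longlonglongrightarrow> c"
begin

lemma critical_limits: "err \<longlonglongrightarrow> 0" "s \<longlonglongrightarrow> 0"
proof -
  have "\<forall>\<^sub>F n in sequentially. c - 1 < lam n" using lam_c by (rule order_tendstoD) simp
  then have "\<forall>\<^sub>F n in sequentially. - (1 - c) \<le> lam n" by eventually_elim simp
  from err_s_tendsto[OF this] show "err \<longlonglongrightarrow> 0" "s \<longlonglongrightarrow> 0" .
qed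

lemma CL_IS_tendsto:
  "(\<lambda>n. CL n k) \<longlonglongrightarrow> exp c ^ k / fact k" "(\<lambda>n. IS n k) \<longlonglongrightarrow> exp c ^ k / fact k"
proof -
  have "(\<lambda>n. real (n choose k) / real n ^ k * D n ^ k) \<longlonglongrightarrow> 1 / fact k * exp (c + 0) ^ k"
    unfolding D_def by (intro tendsto_intros choose_div_power_tendsto lam_c critical_limits)
  then have up: "(\<lambda>n. real (n choose k) / real n ^ k * D n ^ k) \<longlonglongrightarrow> exp c ^ k / fact k" by simp
  have "(\<lambda>n. real (n choose k) / real n ^ k * exp (real k * lam n - 2 * ((real k)\<^sup>2 * s n))) \<longlonglongrightarrow>
      1 / fact k * exp (real k * c - 2 * ((real k)\<^sup>2 * 0))"
    by (intro tendsto_intros choose_div_power_tendsto lam_c critical_limits)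
  then have lo: "(\<lambda>n. real (n choose k) / real n ^ k * exp (real k * lam n - 2 * ((real k)\<^sup>2 * s n))) \<longlonglongrightarrow> exp c ^ k / fact k"
    by (simp add: exp_of_nat_mult)
  have ev: "\<forall>\<^sub>F n in sequentially. real (n choose k) / real n ^ k * exp (real k * lam n - 2 * ((real k)\<^sup>2 * s n)) \<le> IS n k \<and>
      IS n k \<le> CL n k \<and> CL n k \<le> real (n choose k) / real n ^ k * D n ^ k"
    using small_s_eventually[OF critical_limits(2), of k] small_k_eventually[of k] eventually_ge_at_top[of 2]
    by eventually_elim (intro conjI IS_ge_lam IS_le_CL CL_le_D)
  show "(\<lambda>n. CL n k) \<longlonglongrightarrow> exp c ^ k / fact k"
    by (rule tendsto_sandwich[OF _ _ lo up]) (use ev in \<open>eventually_elim, linarith\<close>)+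
  show "(\<lambda>n. IS n k) \<longlonglongrightarrow> exp c ^ k / fact k"
    by (rule tendsto_sandwich[OF _ _ lo up]) (use ev in \<open>eventually_elim, linarith\<close>)+
qed

text \<open>For fixed r the Bonferroni sum converges to a partial sum of the exponential series at -
  exp c. Letting n grow first and choosing r large afterwards avoids any uniformity in r.\<close>

lemma p0_tendsto: "p0 \<longlonglongrightarrow> exp (- exp c)"
proof -
  define S where "S r = (\<Sum>k\<le>r. (-1) ^ k * (exp c ^ k / fact k))" for r
  have T: "(\<lambda>n. \<Sum>k\<le>r. (-1) ^ k * IS n k) \<longlonglongrightarrow> S r" for r
    unfolding S_def by (intro tendsto_intros CL_IS_tendsto)
  have "(\<lambda>j. (- exp c) ^ j /\<^sub>R fact j) sums exp (- exp c)" by (rule exp_converges)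
  moreover have "(- exp c) ^ j /\<^sub>R fact j = (-1) ^ j * (exp c ^ j / fact j)" for j
    by (simp add: power_minus[of "exp c"] divide_inverse mult_ac)
  ultimately have S: "S \<longlonglongrightarrow> exp (- exp c)"
    unfolding S_def sums_def_le by simp
  show ?thesis
  proof (rule order_tendstoI)
    fix a assume "a > exp (- exp c)"
    then have "\<forall>\<^sub>F r in sequentially. S r < a" using S by (intro order_tendstoD)
    then obtain R where R: "\<And>r. r \<ge> R \<Longrightarrow> S r < a" by (auto simp: eventually_sequentially)
    then have "S (2 * R) < a" by simp
    then have "\<forall>\<^sub>F n in sequentially. (\<Sum>k\<le>2 * R. (-1) ^ k * IS n k) < a"
      using T by (intro order_tendstoD)
    then show "\<forall>\<^sub>F n in sequentially. p0 n < a" using eventually_ge_at_top[of 2]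
      by eventually_elim (use bonferroni_even[of _ "2 * R"] in fastforce)
  next
    fix a assume "a < exp (- exp c)"
    then have "\<forall>\<^sub>F r in sequentially. a < S r" using S by (intro order_tendstoD)
    then obtain R where R: "\<And>r. r \<ge> R \<Longrightarrow> a < S r" by (auto simp: eventually_sequentially)
    then have "a < S (2 * R + 1)" by simp
    then have "\<forall>\<^sub>F n in sequentially. a < (\<Sum>k\<le>2 * R + 1. (-1) ^ k * IS n k)"
      using T by (intro order_tendstoD)
    then show "\<forall>\<^sub>F n in sequentially. a < p0 n" using eventually_ge_at_top[of 2]
      by eventually_elim (use bonferroni_odd[of _ "2 * R + 1"] in fastforce)
  qed
qed

text \<open>Each term CL - IS vanishes in the limit, but the number of terms grows with n. For small
  k Tannery's theorem applies with the dominating series of exp (exp (c + 1)); the large k are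
  negligible in total.\<close>

lemma p_tendsto: "p \<longlonglongrightarrow> exp (- exp c)"
proof -
  \<comment> \<open>Extending by 0 turns the sum over a range depending on n into a series over all
    k.\<close>
  define a where "a k n = (if k \<in> small n \<and> k \<ge> 2 then CL n k - IS n k else 0)" for k n
  have lam_le: "\<forall>\<^sub>F n in sequentially. lam n \<le> c + 1"
    using order_tendstoD(2)[OF lam_c, of "c + 1"] by (auto elim: eventually_mono)
  have "(\<lambda>n. lam n + err n) \<longlonglongrightarrow> c + 0" by (intro tendsto_intros lam_c critical_limits)
  then have "\<forall>\<^sub>F n in sequentially. lam n + err n < c + 1" by (intro order_tendstoD) auto
  then have D_le: "\<forall>\<^sub>F n in sequentially. D n \<le> exp (c + 1)" by eventually_elim (simp add: D_def)
  have bound: "\<forall>\<^sub>F n in sequentially. \<forall>k. norm (a k n) \<le> exp (c + 1) ^ k / fact k"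
    using D_le eventually_ge_at_top[of 2]
  proof eventually_elim
    case (elim n)
    show ?case
    proof
      fix k
      show "norm (a k n) \<le> exp (c + 1) ^ k / fact k"
      proof (cases "k \<in> small n \<and> k \<ge> 2")
        case True
        then have "CL n k \<le> D n ^ k / fact k" by (intro CL_le_D_fact elim) (auto simp: small_def)
        also have "\<dots> \<le> exp (c + 1) ^ k / fact k"
          using elim by (intro divide_right_mono power_mono) (auto simp: D_def)
        finally show ?thesis using True IS_le_CL[OF elim(2), of k] IS_nonneg[OF elim(2), of k] by (simp add: a_def)
      qed (auto simp: a_def)
    qed
  qed
  have summ: "summable (\<lambda>k. exp (c + 1) ^ k / fact k)"
    using summable_exp_generic[of "exp (c + 1)"] by (simp add: divide_inverse mult.commute)
  have lim: "(\<lambda>n. a k n) \<longlonglongrightarrow> 0" for k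
  proof (rule tendsto_sandwich[of "\<lambda>_. 0" _ _ "\<lambda>n. CL n k - IS n k"])
    show "\<forall>\<^sub>F n in sequentially. 0 \<le> a k n"
      using eventually_ge_at_top[of 2] by eventually_elim (use IS_le_CL in \<open>simp add: a_def\<close>)
    show "\<forall>\<^sub>F n in sequentially. a k n \<le> CL n k - IS n k"
      using eventually_ge_at_top[of 2] by eventually_elim (use IS_le_CL in \<open>simp add: a_def\<close>)
    show "(\<lambda>n. CL n k - IS n k) \<longlonglongrightarrow> 0"
      using tendsto_diff[OF CL_IS_tendsto[of k]] by simp
  qed simp
  \<comment> \<open>The bound holds for every k at once, so only n has to be taken large in the
    product filter.\<close>
  have "\<forall>\<^sub>F (k, n) in at_top \<times>\<^sub>F sequentially. norm (a k n) \<le> exp (c + 1) ^ k / fact k"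
    unfolding eventually_prod_filter
    by (rule exI[of _ "\<lambda>_. True"], rule exI[of _ "\<lambda>n. \<forall>k. norm (a k n) \<le> exp (c + 1) ^ k / fact k"])
       (use bound in auto)
  then have "(\<lambda>n. \<Sum>k. a k n) \<longlonglongrightarrow> (\<Sum>k. 0)"
    using tannerys_theorem[OF lim _ summ] by auto
  moreover have "(\<Sum>k. a k n) = (\<Sum>k\<in>small n. a k n)" for n
    using small_large(1) by (intro suminf_finite) (auto simp: a_def)
  ultimately have A: "(\<lambda>n. \<Sum>k\<in>small n. a k n) \<longlonglongrightarrow> 0" by simp
  have upper: "(\<lambda>n. (\<Sum>k\<in>small n. a k n) + real n * exp (- (real n powr (1/4)))) \<longlonglongrightarrow> 0 + 0"
    by (intro tendsto_add A large_bound_tendsto)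
  have ev: "\<forall>\<^sub>F n in sequentially. p0 n - p n \<le> (\<Sum>k\<in>small n. a k n) + real n * exp (- (real n powr (1/4)))"
    using large_sum_le[OF lam_le] eventually_ge_at_top[of 2]
  proof eventually_elim
    case (elim n)
    let ?b = "\<lambda>k. if k \<ge> 2 then CL n k - IS n k else 0"
    have "(\<Sum>k\<in>{2..n div 2}. CL n k - IS n k) = (\<Sum>k\<in>{1..n div 2}. ?b k)"
      by (rule sum.mono_neutral_cong_left) auto
    also have "\<dots> = (\<Sum>k\<in>small n. ?b k) + (\<Sum>k\<in>large n. ?b k)"
      unfolding small_large(3) by (rule sum.union_disjoint) (use small_large in auto)
    also have "(\<Sum>k\<in>small n. ?b k) = (\<Sum>k\<in>small n. a k n)" by (intro sum.cong) (auto simp: a_def)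
    also have "(\<Sum>k\<in>large n. ?b k) \<le> (\<Sum>k\<in>large n. CL n k)"
      using IS_nonneg[OF elim(2)] IS_le_CL[OF elim(2)] by (intro sum_mono) (auto intro: order_trans)
    finally show ?case using p0_p[OF elim(2)] elim(1) by linarith
  qed
  have "(\<lambda>n. p0 n - p n) \<longlonglongrightarrow> 0"
  proof (rule tendsto_sandwich[OF _ ev tendsto_const])
    show "\<forall>\<^sub>F n in sequentially. 0 \<le> p0 n - p n"
      using eventually_ge_at_top[of 2] by eventually_elim (use p_bounds in fastforce)
  qed (use upper in simp)
  from tendsto_diff[OF p0_tendsto this] show ?thesis by simp
qed

end

end

section \<open>From the mixture law and the layers to the threshold inequalities\<close>

theorem theorem2:
  fixes c :: real
    and m :: "nat \<Rightarrow> nat"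
    and M :: "nat \<Rightarrow> 'a measure"
    and X :: "nat \<Rightarrow> nat \<Rightarrow> 'a \<Rightarrow> nat"
    and Q :: "nat \<Rightarrow> nat \<Rightarrow> 'a \<Rightarrow> real"
    and V :: "nat \<Rightarrow> nat \<Rightarrow> 'a \<Rightarrow> nat set"
    and E :: "nat \<Rightarrow> nat \<Rightarrow> 'a \<Rightarrow> nat set set"
    and I :: "nat \<Rightarrow> 'a \<Rightarrow> nat"
    and N :: "'b measure"
    and X' :: "'b \<Rightarrow> nat"
    and Q' :: "'b \<Rightarrow> real"
    and Xs :: "nat \<Rightarrow> 'a \<Rightarrow> nat"
    and Qs :: "nat \<Rightarrow> 'a \<Rightarrow> real"
    and \<kappa> lam :: "nat \<Rightarrow> real"
  assumes m_pos: "\<And>n. n \<ge> 1 \<Longrightarrow> m n > 0"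
    and m_lim: "filterlim m at_top sequentially"
    and layers: "\<And>n. n \<ge> 1 \<Longrightarrow> independent_random_layers (M n) n (m n) (X n) (Q n) (V n) (E n)"
    and index: "\<And>n. n \<ge> 1 \<Longrightarrow> uniform_independent_index (M n) (m n) (X n) (Q n) (I n)"
    and Xs: "\<And>n. Xs n = at_index (I n) (X n)"
    and Qs: "\<And>n. Qs n = at_index (I n) (Q n)"
    and N: "prob_space N"
    and X'_meas: "X' \<in> measurable N (count_space UNIV)"
    and Q'_meas: "Q' \<in> borel_measurable N"
    and Q'_range: "\<And>\<omega>. \<omega> \<in> space N \<Longrightarrow> Q' \<omega> \<in> {0..1}"
    and conv: "converges_in_distribution M (\<lambda>n \<omega>. (real (Xs n \<omega>), Qs n \<omega>)) N
                 (\<lambda>\<omega>. (real (X' \<omega>), Q' \<omega>))"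
    and nontrivial: "(\<integral>\<omega>. Q' \<omega> * indicator {\<omega>. X' \<omega> \<ge> 2} \<omega> \<partial>N) > 0"
    and moment: "integrable N (\<lambda>\<omega>. real (X' \<omega>) * h (real (X' \<omega>)) (Q' \<omega>) * ln (1 + real (X' \<omega>)))"
    and moment_conv:
      "(\<lambda>n. \<integral>\<omega>. real (Xs n \<omega>) * h (real (Xs n \<omega>)) (Qs n \<omega>) * ln (1 + real (Xs n \<omega>)) \<partial>M n)
         \<longlonglongrightarrow> (\<integral>\<omega>. real (X' \<omega>) * h (real (X' \<omega>)) (Q' \<omega>) * ln (1 + real (X' \<omega>)) \<partial>N)"
    and \<kappa>: "\<And>n. \<kappa> n = (\<integral>\<omega>. real (Xs n \<omega>) * h (real (Xs n \<omega>)) (Qs n \<omega>) \<partial>M n)"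
    and lam: "\<And>n. lam n = ln (real n) - real (m n) / real n * \<kappa> n"
  shows
    "(filterlim lam at_bot sequentially \<longrightarrow>
        (\<lambda>n. measure (M n) {\<omega>\<in>space (M n). graph_connected {1..n} (union_edges (m n) (E n) \<omega>)})
          \<longlonglongrightarrow> 1) \<and>
     (lam \<longlonglongrightarrow> c \<longrightarrow>
        (\<lambda>n. measure (M n) {\<omega>\<in>space (M n). graph_connected {1..n} (union_edges (m n) (E n) \<omega>)})
          \<longlonglongrightarrow> exp (- exp c)) \<and>
     (filterlim lam at_top sequentially \<longrightarrow>
        (\<lambda>n. measure (M n) {\<omega>\<in>space (M n). graph_connected {1..n} (union_edges (m n) (E n) \<omega>)})
          \<longlonglongrightarrow> 0)"
proof -
  have G: "layered_graph (M n) n (m n) (X n) (Q n) (V n) (E n)" if "n \<ge> 1" for n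
    using layers[OF that] m_pos[OF that]
    by (auto simp: layered_graph_def layered_graph_axioms_def independent_random_layers_def)
  have I: "I n \<in> measurable (M n) (count_space {1..m n})" if "n \<ge> 1" for n
    using index[OF that] by (simp add: uniform_independent_index_def)
  interpret L: limit_law M Xs Qs N X' Q'
  proof (rule limit_law.intro)
    fix n :: nat assume n: "n \<ge> 1"
    interpret layered_graph "M n" n "m n" "X n" "Q n" "V n" "E n" by (rule G[OF n])
    show "prob_space (M n)" by (rule prob_space_axioms)
    show "Xs n \<in> measurable (M n) (count_space UNIV)"
      unfolding Xs at_index_def
      by (rule measurable_compose_countable'[OF measurable_layer(1) I[OF n] countable_finite]) simp_all
    show "Qs n \<in> borel_measurable (M n)"
      unfolding Qs at_index_def
      by (rule measurable_compose_countable'[OF measurable_layer(2) I[OF n] countable_finite]) simp_all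
    fix \<omega> assume \<omega>: "\<omega> \<in> space (M n)"
    have "I n \<omega> \<in> {1..m n}" using measurable_space[OF I[OF n] \<omega>] by simp
    then show "Xs n \<omega> \<le> n" "Qs n \<omega> \<in> {0..1}"
      using layer_range(1,2)[OF _ \<omega>] by (simp_all only: Xs Qs at_index_def)
  qed (fact N X'_meas Q'_meas Q'_range conv nontrivial moment moment_conv)+
  \<comment> \<open>The law at the random index is the average of the layer laws. This identity
    translates sums over layers into mixture means; the weight \<open>f\<close> may be arbitrary
    because sizes are bounded by n.\<close>
  have mean_eq: "real (m n) * L.mean n f = (\<Sum>i=1..m n. \<integral>\<omega>. f (X n i \<omega>) * h (real (X n i \<omega>)) (Q n i \<omega>) \<partial>M n)"
    if n: "n \<ge> 1" for n f
  proof -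
    interpret layered_graph "M n" n "m n" "X n" "Q n" "V n" "E n" by (rule G[OF n])
    let ?g = "\<lambda>z. f (fst z) * h (real (fst z)) (snd z)"
    have "integrable (M n) (\<lambda>\<omega>. ?g (X n i \<omega>, Q n i \<omega>))" if "i \<in> {1..m n}" for i
    proof (rule integrable_layer[OF that L.h_pair_measurable])
      fix x and q :: real assume xq: "x \<le> n" "q \<in> {0..1}"
      have "\<bar>?g (x, q)\<bar> \<le> \<bar>f x\<bar>"
        using h_bounds[OF xq(2), of x] by (simp add: abs_mult mult_left_le)
      also have "\<dots> \<le> Max ((\<lambda>x. \<bar>f x\<bar>) ` {..n})" using xq by (intro Max_ge) auto
      finally show "\<bar>?g (x, q)\<bar> \<le> Max ((\<lambda>x. \<bar>f x\<bar>) ` {..n})" .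
    qed
    from expectation_at_index[OF prob_space_axioms index[OF n] L.h_pair_measurable this]
    show ?thesis using m_pos by (simp add: L.mean_def Xs Qs field_simps)
  qed
  have \<kappa>_eq: "\<kappa> n = L.mean n real" for n by (simp add: \<kappa> L.mean_def)
  \<comment> \<open>Taking the locale constants with explicit parameters defines these sequences for
    every n, including n = 0, where nothing is assumed about the layers.\<close>
  define CL where "CL n = layered_graph.closed_sum (M n) n (m n) (E n)" for n
  define IS where "IS n = layered_graph.isolated_sum (M n) n (m n) (E n)" for n
  define p where "p n = layered_graph.prob_connected (M n) n (m n) (E n)" for n
  define p0 where "p0 n = layered_graph.prob_no_isolated (M n) n (m n) (E n)" for n
  \<comment> \<open>With t = k / n the quadratic error of the isolation bound is k^2 times this
    quantity.\<close>
  define s where "s n = (\<Sum>i=1..m n. (layered_graph.kappa (M n) (X n) (Q n) i)\<^sup>2) / (real n)\<^sup>2" for n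
  note seq_defs = CL_def IS_def p_def p0_def s_def
  have sums: "(\<Sum>i=1..m n. layered_graph.kappa (M n) (X n) (Q n) i) = real (m n) * \<kappa> n"
      "(\<Sum>i=1..m n. layered_graph.truncated (M n) (X n) (Q n) A i) = real (m n) * (\<kappa> n - L.tail n A)"
      "(\<Sum>i=1..m n. layered_graph.edge_mean (M n) (X n) (Q n) i) = real (m n) * L.mean n (\<lambda>_. 1)"
    if n: "n \<ge> 1" for n A
  proof -
    interpret layered_graph "M n" n "m n" "X n" "Q n" "V n" "E n" by (rule G[OF n])
    show "(\<Sum>i=1..m n. kappa i) = real (m n) * \<kappa> n"
      unfolding kappa_def \<kappa>_eq mean_eq[OF n] ..
    have "\<kappa> n - L.tail n A = L.mean n (\<lambda>x. real x - real x * of_bool (A < real x))"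
      unfolding \<kappa>_eq L.tail_def L.mean_diff[OF n] ..
    also have "(\<lambda>x. real x - real x * of_bool (A < real x)) = (\<lambda>x. real x * of_bool (real x \<le> A))"
      by (auto simp: of_bool_def)
    finally show "(\<Sum>i=1..m n. truncated A i) = real (m n) * (\<kappa> n - L.tail n A)"
      using mean_eq[OF n, of "\<lambda>x. real x * of_bool (real x \<le> A)"]
      unfolding truncated_def by (simp add: mult_ac)
    show "(\<Sum>i=1..m n. edge_mean i) = real (m n) * L.mean n (\<lambda>_. 1)"
      unfolding edge_mean_def mean_eq[OF n] by simp
  qed
  interpret T: threshold "\<lambda>n. real (m n) / real n" \<kappa> "\<lambda>n. L.mean n (\<lambda>_. 1)" s lam p p0 L.tail CL IS
  proof
    show "0 \<le> real (m n) / real n" "lam n = ln (real n) - real (m n) / real n * \<kappa> n" for n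
      by (simp_all add: lam)
    show "(\<lambda>n. L.tail n (sqrt (real n)) * ln (real n)) \<longlonglongrightarrow> 0" by (rule L.tail_sqrt_ln_tendsto)
    show "\<exists>A\<ge>0. \<forall>\<^sub>F n in sequentially. L.tail n A \<le> \<epsilon>" if "\<epsilon> > 0" for \<epsilon>
      using L.tail_le[OF that] of_nat_0_le_iff by blast
    show "\<exists>K>0. \<forall>\<^sub>F n in sequentially. \<kappa> n \<le> K" unfolding \<kappa>_eq by (rule L.mean_id_bounded)
    show "\<exists>a>0. \<forall>\<^sub>F n in sequentially. a \<le> L.mean n (\<lambda>_. 1)" by (rule L.mean_one_bounded_below)
  next
    fix n :: nat assume n2: "n \<ge> 2"
    then have n: "n \<ge> 1" by simp
    interpret G: layered_graph "M n" n "m n" "X n" "Q n" "V n" "E n" by (rule G[OF n])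
    show "L.mean n (\<lambda>_. 1) \<le> \<kappa> n" unfolding \<kappa>_eq by (rule L.mean_one_le_mean_id[OF n])
    have tail: "0 \<le> L.tail n A \<and> L.tail n A \<le> \<kappa> n" for A
      using L.tail_nonneg[OF n] L.mean_mono[OF n, of "\<lambda>x. real x * of_bool (A < real x)" real]
      by (auto simp: \<kappa>_eq L.tail_def)
    then show "0 \<le> L.tail n A \<and> L.tail n A \<le> \<kappa> n" for A .
    \<comment> \<open>The cutoff sqrt n balances the two parts: the small sizes give a term of order
      \<mu> \<kappa> / sqrt n, and the large ones give \<mu> times the tail that is o(1 / ln
      n).\<close>
    have "s n \<le> (2 * sqrt (real n) * (real (m n) * \<kappa> n) + 2 * real n * (real (m n) * L.tail n (sqrt (real n)))) / (real n)\<^sup>2"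
      unfolding s_def using G.sum_kappa_squares_le[of "sqrt (real n)", unfolded sum_subtractf sums[OF n]]
      by (intro divide_right_mono) (simp_all add: right_diff_distrib)
    also have "\<dots> = 2 * (real (m n) / real n * \<kappa> n) / sqrt (real n) + 2 * (real (m n) / real n * L.tail n (sqrt (real n)))"
    proof -
      have "sqrt (real n) / (real n)\<^sup>2 = 1 / real n / sqrt (real n)"
        using n by (simp add: field_simps power2_eq_square)
      then have "2 * (real (m n) * \<kappa> n) * (sqrt (real n) / (real n)\<^sup>2) = 2 * (real (m n) * \<kappa> n) * (1 / real n / sqrt (real n))"
        by (rule arg_cong)
      then have "2 * sqrt (real n) * (real (m n) * \<kappa> n) / (real n)\<^sup>2 = 2 * (real (m n) / real n * \<kappa> n) / sqrt (real n)"
        by (simp add: mult_ac)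
      then show ?thesis using n by (simp add: add_divide_distrib power2_eq_square)
    qed
    finally show "0 \<le> s n \<and> s n \<le> 2 * (real (m n) / real n * \<kappa> n) / sqrt (real n) + 2 * (real (m n) / real n * L.tail n (sqrt (real n)))"
      by (simp add: s_def sum_nonneg)
    show "IS n k \<le> CL n k" for k unfolding seq_defs by (rule G.isolated_sum_le_closed_sum)
    show "0 \<le> IS n k" for k unfolding seq_defs by (rule G.isolated_sum_nonneg)
    show "CL n k \<le> real (n choose k) *
        exp (- (real k * (1 - A * (real k / real n)) * (real (m n) / real n * (\<kappa> n - L.tail n A))))" for k A
      unfolding seq_defs using G.prob_closed_le_truncated[of _ A, unfolded sums[OF n]]
      by (intro G.closed_sum_le) (auto simp: mult_ac)
    show "CL n k \<le> real (n choose k) * exp (- (real k * (real (m n) / real n * L.mean n (\<lambda>_. 1))))"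
      if "2 * k \<le> n" for k
      unfolding seq_defs using G.prob_closed_le_edge_mean[unfolded sums[OF n]] that
      by (intro G.closed_sum_le) (auto simp: mult_ac)
    show "real (n choose k) * exp (- (real k * (real (m n) / real n * \<kappa> n)) - 2 * ((real k)\<^sup>2 * s n)) \<le> IS n k"
      if "(real k)\<^sup>2 * s n \<le> 1/4" for k
      unfolding IS_def
    proof (rule G.isolated_sum_ge)
      fix S assume S: "S \<subseteq> {1..n}" "card S = k"
      have sq: "(real (card S) / real n)\<^sup>2 * (\<Sum>i=1..m n. (G.kappa i)\<^sup>2) = (real k)\<^sup>2 * s n"
        by (simp add: S s_def power_divide)
      have ln: "real (card S) / real n * (\<Sum>i=1..m n. G.kappa i) = real k * (real (m n) / real n * \<kappa> n)"
        by (simp only: sums[OF n] S) simp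
      show "exp (- (real k * (real (m n) / real n * \<kappa> n)) - 2 * ((real k)\<^sup>2 * s n)) \<le>
          G.prob {\<omega> \<in> space (M n). isolated_vertices S (G.graph \<omega>)}"
        using G.prob_isolated_ge[OF S(1)] that unfolding sq ln by simp
    qed
    show "1 - (\<Sum>k\<in>{1..n div 2}. CL n k) \<le> p n" unfolding seq_defs by (rule G.prob_connected_ge)
    show "0 \<le> p n \<and> p n \<le> p0 n \<and> p0 n \<le> 1"
      unfolding seq_defs using G.prob_connected_le[OF n2]
      by (simp add: G.prob_connected_def G.prob_no_isolated_def)
    show "p0 n - p n \<le> (\<Sum>k\<in>{2..n div 2}. CL n k - IS n k)"
      unfolding seq_defs by (rule G.prob_no_isolated_le_connected)
    show "p0 n \<le> (\<Sum>k\<le>r. (-1) ^ k * IS n k)" if "even r" for r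
      unfolding seq_defs by (rule G.bonferroni_upper[OF that])
    show "(\<Sum>k\<le>r. (-1) ^ k * IS n k) \<le> p0 n" if "odd r" for r
      unfolding seq_defs by (rule G.bonferroni_lower[OF that])
    show "p0 n \<le> (2 * IS n 2 + IS n 1) / (IS n 1)\<^sup>2 - 1" if "IS n 1 > 0"
      using that unfolding seq_defs by (rule G.prob_no_isolated_second_moment)
  qed
  have "\<forall>\<^sub>F n in sequentially. p n =
      measure (M n) {\<omega>\<in>space (M n). graph_connected {1..n} (union_edges (m n) (E n) \<omega>)}"
    using eventually_ge_at_top[of 1]
  proof eventually_elim
    case (elim n)
    interpret layered_graph "M n" n "m n" "X n" "Q n" "V n" "E n" by (rule G[OF elim])
    show ?case unfolding p_def prob_connected_def graph_def ..
  qed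
  note transfer = Lim_transform_eventually[OF _ this]
  show ?thesis
    using transfer[OF T.connected_whp] transfer[OF T.p_tendsto] transfer[OF T.disconnected_whp] by blast
qed

end
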